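(* Let $\lambda>0$, let $G$ be a probability distribution on $(0,\infty)$, and let $(V_t^{2,x})_{t\ge0}$, $x\ge0$, be the Model 2 workload process with arrival rate $\lambda$ and service distribution $G$. If $\mathbb{E}\bigl(r^{S_1}\bigr)<\infty$ for some $r>1$, then the process is geometrically ergodic.
   Context: Model 2 (M/G/1 workload with bounded waiting time, threshold 1). Let $T_0=0$ and let the inter-arrival times $T_i-T_{i-1}$, $i\ge1$, be i.i.d. exponential with mean $1/\lambda$; let $(S_n)_{n\ge1}$ be i.i.d. with distribution $G$ on $(0,\infty)$, independent of $(T_n)$. For $x\ge0$ define $V^{2,x}_0=x$, $$V^{2,x}_t=\max[V^{2,x}_{T_{n-1}}-(t-T_{n-1}),0]\quad(T_{n-1}\le t<T_n,\ n\ge1),\qquad V^{2,x}_{T_n}=V^{2,x}_{T_n-}+S_n\mathbf{1}_{\{V^{2,x}_{T_n-}<1\}}\quad(n\ge1),$$ where $V^{2,x}_{T_n-}$ is the left limit at $T_n$. Geometric ergodicity: there are an invariant probability distribution $\pi$ on $[0,\infty)$, a constant $\alpha>0$ and, for each $x\ge0$, a finite constant $C_{x,\alpha}>0$ such that $\|\mathbb{P}(V_t^{2,x}\in\cdot)-\pi\|_{TV}\le C_{x,\alpha}e^{-\alpha t}$ for all $t\ge0$ and all $x\ge0$, where $\|\mu-\nu\|_{TV}=\sup_{A\text{ Borel}}|\mu(A)-\nu(A)|$. *)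

theory Defs
  imports "HOL-Probability.Probability"
begin

text \<open>
  Sample paths, as functions of the arrival epochs \<open>\<tau> 0 = 0 < \<tau> 1 < \<dots>\<close> and the service
  requirements \<open>s 1, s 2, \<dots>\<close> (the value \<open>s 0\<close> is not used).  \<open>workload_at_arrival \<tau> s x n\<close> is the
  workload at time \<open>\<tau> n\<close>, just after the arrival.  The lemmas \<open>workload_zero\<close>,
  \<open>workload_between\<close> and \<open>workload_jump\<close> give the defining recursion of the process.
\<close>

primrec workload_at_arrival :: "(nat \<Rightarrow> real) \<Rightarrow> (nat \<Rightarrow> real) \<Rightarrow> real \<Rightarrow> nat \<Rightarrow> real" where
  "workload_at_arrival \<tau> s x 0 = x"
| "workload_at_arrival \<tau> s x (Suc n) =
     (let v = Lim (at_left (\<tau> (Suc n))) (\<lambda>t. max (workload_at_arrival \<tau> s x n - (t - \<tau> n)) 0)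
      in v + s (Suc n) * of_bool (v < 1))"

text \<open>
  The index \<open>n\<close> below is the one with \<open>\<tau> n \<le> t < \<tau> (Suc n)\<close>.  It is meaningless if all epochs are
  at most \<open>t\<close>, which has probability zero for Poisson arrivals.
\<close>

definition workload :: "(nat \<Rightarrow> real) \<Rightarrow> (nat \<Rightarrow> real) \<Rightarrow> real \<Rightarrow> real \<Rightarrow> real" where
  "workload \<tau> s x t =
     (let n = (LEAST n. t < \<tau> (Suc n)) in max (workload_at_arrival \<tau> s x n - (t - \<tau> n)) 0)"

lemma workload_segment:
  assumes "strict_mono \<tau>" "\<tau> n \<le> t" "t < \<tau> (Suc n)"
  shows "workload \<tau> s x t = max (workload_at_arrival \<tau> s x n - (t - \<tau> n)) 0"
proof -
  have "(LEAST n. t < \<tau> (Suc n)) = n"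
  proof (rule Least_equality)
    show "t < \<tau> (Suc n)" by (fact assms(3))
  next
    fix m assume "t < \<tau> (Suc m)"
    with assms(2) have "\<tau> n < \<tau> (Suc m)" by simp
    then show "n \<le> m" using strict_mono_less[OF assms(1)] by simp
  qed
  then show ?thesis by (simp add: workload_def)
qed

lemma Lim_segment:
  "Lim (at_left b) (\<lambda>t. max (w - (t - a)) 0) = max (w - (b - a)) (0::real)"
  by (rule tendsto_Lim) (auto intro!: tendsto_intros)

lemma workload_at_arrival_nonneg:
  assumes "x \<ge> 0" "\<And>n. n \<ge> 1 \<Longrightarrow> s n > 0"
  shows "workload_at_arrival \<tau> s x n \<ge> 0"
proof (cases n)
  case (Suc m)
  have "s (Suc m) > 0" using assms(2) by simp
  then show ?thesis by (simp add: Suc Let_def Lim_segment of_bool_def)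
qed (use assms in simp)

lemma workload_at_epoch:
  assumes "strict_mono \<tau>" "x \<ge> 0" "\<And>n. n \<ge> 1 \<Longrightarrow> s n > 0"
  shows "workload \<tau> s x (\<tau> n) = workload_at_arrival \<tau> s x n"
proof -
  have "\<tau> n < \<tau> (Suc n)" using assms(1) by (simp add: strict_mono_less)
  then show ?thesis
    using workload_segment[OF assms(1) order_refl, of n s x]
      workload_at_arrival_nonneg[of x s \<tau> n] assms by simp
qed

lemma workload_zero:
  assumes "strict_mono \<tau>" "\<tau> 0 = 0" "x \<ge> 0" "\<And>n. n \<ge> 1 \<Longrightarrow> s n > 0"
  shows "workload \<tau> s x 0 = x"
  using workload_at_epoch[of \<tau> x s 0] assms by simp

lemma workload_between:
  assumes "strict_mono \<tau>" "x \<ge> 0" "\<And>n. n \<ge> 1 \<Longrightarrow> s n > 0"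
    and "n \<ge> 1" "\<tau> (n - 1) \<le> t" "t < \<tau> n"
  shows "workload \<tau> s x t = max (workload \<tau> s x (\<tau> (n - 1)) - (t - \<tau> (n - 1))) 0"
  using workload_segment[of \<tau> "n - 1" t s x] workload_at_epoch[of \<tau> x s "n - 1"] assms by simp

lemma workload_jump:
  assumes "strict_mono \<tau>" "x \<ge> 0" "\<And>n. n \<ge> 1 \<Longrightarrow> s n > 0" and "n \<ge> 1"
  obtains v where "(workload \<tau> s x \<longlongrightarrow> v) (at_left (\<tau> n))"
    and "workload \<tau> s x (\<tau> n) = v + s n * of_bool (v < 1)"
proof -
  obtain m where n: "n = Suc m" using assms(4) by (cases n) auto
  define f where "f = (\<lambda>t. max (workload_at_arrival \<tau> s x m - (t - \<tau> m)) 0)"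
  have less: "\<tau> m < \<tau> n" using assms(1) by (simp add: n strict_mono_less)
  have f: "(f \<longlongrightarrow> f (\<tau> n)) (at_left (\<tau> n))"
    unfolding f_def by (auto intro!: tendsto_intros)
  have "\<forall>\<^sub>F t in at_left (\<tau> n). t \<in> {\<tau> m<..<\<tau> n}"
    using less by (rule eventually_at_leftI[rotated]) auto
  then have "\<forall>\<^sub>F t in at_left (\<tau> n). f t = workload \<tau> s x t"
    by eventually_elim (auto simp: f_def n intro!: workload_segment[OF assms(1), symmetric])
  then have lim: "(workload \<tau> s x \<longlongrightarrow> f (\<tau> n)) (at_left (\<tau> n))"
    using f by (rule Lim_transform_eventually[rotated])
  have "workload \<tau> s x (\<tau> n) = f (\<tau> n) + s n * of_bool (f (\<tau> n) < 1)"
    using workload_at_epoch[of \<tau> x s n] assms by (simp add: n f_def Lim_segment Let_def)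
  with lim show thesis by (rule that)
qed

locale mg1_input = prob_space M
  for M :: "'a measure" and rate :: real and G :: "real measure"
    and T :: "nat \<Rightarrow> 'a \<Rightarrow> real" and S :: "nat \<Rightarrow> 'a \<Rightarrow> real" +
  assumes rate_pos: "rate > 0"
    and prob_space_G: "prob_space G"
    and sets_G: "sets G = sets borel"
    and G_pos: "emeasure G {0<..} = 1"
    and T_0: "\<And>\<omega>. \<omega> \<in> space M \<Longrightarrow> T 0 \<omega> = 0"
    and interarrival_distributed:
      "\<And>i. i \<ge> 1 \<Longrightarrow> distributed M lborel (\<lambda>\<omega>. T i \<omega> - T (i - 1) \<omega>) (exponential_density rate)"
    and interarrival_indep: "indep_vars (\<lambda>_. borel) (\<lambda>i \<omega>. T i \<omega> - T (i - 1) \<omega>) {1..}"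
    and service_measurable: "\<And>n. n \<ge> 1 \<Longrightarrow> S n \<in> borel_measurable M"
    and service_distr: "\<And>n. n \<ge> 1 \<Longrightarrow> distr M borel (S n) = G"
    and service_indep: "indep_vars (\<lambda>_. borel) S {1..}"
    and arrival_service_indep:
      "indep_var (\<Pi>\<^sub>M n\<in>UNIV. borel) (\<lambda>\<omega>. \<lambda>n\<in>UNIV. T n \<omega>)
                 (\<Pi>\<^sub>M n\<in>{1..}. borel) (\<lambda>\<omega>. \<lambda>n\<in>{1..}. S n \<omega>)"

definition model2 :: "(nat \<Rightarrow> 'a \<Rightarrow> real) \<Rightarrow> (nat \<Rightarrow> 'a \<Rightarrow> real) \<Rightarrow> real \<Rightarrow> real \<Rightarrow> 'a \<Rightarrow> real" where
  "model2 T S x t \<omega> = workload (\<lambda>n. T n \<omega>) (\<lambda>n. S n \<omega>) x t"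

definition tv_dist :: "real measure \<Rightarrow> real measure \<Rightarrow> real" where
  "tv_dist \<mu> \<nu> = (SUP A\<in>sets borel. \<bar>measure \<mu> A - measure \<nu> A\<bar>)"

text \<open>
  A distribution on \<open>[0, \<infinity>)\<close> is represented as a Borel measure on the real line giving mass one to
  \<open>{0..}\<close>.  In the two definitions below, \<open>V x t\<close> is the state at time \<open>t\<close> of the process started
  from \<open>x\<close>, so that \<open>distr M borel (V x t)\<close> is the transition kernel.
\<close>

definition invariant_distribution ::
    "'a measure \<Rightarrow> (real \<Rightarrow> real \<Rightarrow> 'a \<Rightarrow> real) \<Rightarrow> real measure \<Rightarrow> bool" where
  "invariant_distribution M V \<pi> \<longleftrightarrow>
     prob_space \<pi> \<and> sets \<pi> = sets borel \<and> emeasure \<pi> {0..} = 1 \<and>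
     (\<forall>t\<ge>0. \<forall>A\<in>sets borel.
        (\<integral>\<^sup>+ x\<in>{0..}. emeasure (distr M borel (V x t)) A \<partial>\<pi>) = emeasure \<pi> A)"

definition geometrically_ergodic ::
    "'a measure \<Rightarrow> (real \<Rightarrow> real \<Rightarrow> 'a \<Rightarrow> real) \<Rightarrow> bool" where
  "geometrically_ergodic M V \<longleftrightarrow>
     (\<exists>\<pi> \<alpha>. invariant_distribution M V \<pi> \<and> \<alpha> > 0 \<and>
        (\<forall>x\<ge>0. \<exists>C>0. \<forall>t\<ge>0. tv_dist (distr M borel (V x t)) \<pi> \<le> C * exp (- \<alpha> * t)))"

end

theory Submission imports Defs begin

text \<open>
  Conditioning on the first arrival gives a renewal equation for \<open>E f(V_t)\<close>, and bounded subsolutions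
  of such equations lie below supersolutions.  All estimates are obtained by exhibiting supersolutions.

  Run the workloads from \<open>x\<close> and \<open>y\<close> with the same input.  Since an accepted service finds less than one
  unit of work, the larger of the two workloads is dominated by a process that decreases at unit speed and
  jumps from \<open>w\<close> to \<open>max w (1 + s)\<close>, and the two coincide from the time this process reaches zero.  An
  explicit Lyapunov function shows that this hitting time has an exponential tail.  Similarly
  \<open>E exp(\<epsilon> V_t)\<close> is bounded in \<open>t\<close>.  By the Chapman-Kolmogorov equation the laws of \<open>V_t\<close> are
  then Cauchy in total variation at an exponential rate, and their limit is invariant.
\<close>

section \<open>Sample paths\<close>

text \<open>The workload is not monotone in its starting point: of two workloads fed by the same
  input, the smaller may accept a service that the larger refuses, and then overtake it. Hence only
  the maximum of the pair is tracked. No coupled process is constructed: a pair of starting points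
  is merely a state for the renewal equation, and the tail of the coupling time appears as a
  supersolution on pairs. The two nontrivial supersolutions are verified alike: discounted by
  \<open>exp (- rate * u)\<close> and followed along the path that drains without arrivals, they
  must decrease fast enough to pay for their expected value after an arrival at time
  \<open>u\<close>. This is the drift condition of the generator in integrated form. Coupling from
  \<open>x\<close> and \<open>y\<close> costs a multiple of
  \<open>exp (\<epsilon> * x) + exp (\<epsilon> * y)\<close>. Laws at different times are compared
  through a random starting point, which is why a moment bound uniform in time is needed besides the
  coupling.\<close>

definition drain :: "real \<Rightarrow> real \<Rightarrow> real" where
  "drain x t = max (x - t) 0"

definition jump :: "real \<Rightarrow> real \<Rightarrow> real" where
  "jump v y = v + y * of_bool (v < 1)"

text \<open>Gaps instead of epochs, and services indexed from 0: prepending an arrival is then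
  \<open>case_nat\<close> on both sequences, which matches the splitting of an infinite product into
  its first factor and the rest.\<close>

definition workload_path :: "(nat \<Rightarrow> real) \<Rightarrow> (nat \<Rightarrow> real) \<Rightarrow> real \<Rightarrow> real \<Rightarrow> real" where
  "workload_path g s x t = workload (\<lambda>n. \<Sum>i<n. g i) (\<lambda>n. s (n - 1)) x t"

lemma drain_measurable [measurable]:
  assumes [measurable]: "f \<in> borel_measurable N" "h \<in> borel_measurable N"
  shows "(\<lambda>z. drain (f z) (h z)) \<in> borel_measurable N"
  unfolding drain_def by measurable

lemma jump_measurable [measurable]:
  assumes [measurable]: "f \<in> borel_measurable N" "h \<in> borel_measurable N"
  shows "(\<lambda>z. jump (f z) (h z)) \<in> borel_measurable N"
proof -
  have "(\<lambda>z. jump (f z) (h z)) = (\<lambda>z. f z + (if f z < 1 then h z else 0))"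
    by (auto simp: jump_def)
  also have "\<dots> \<in> borel_measurable N" by measurable
  finally show ?thesis .
qed

lemma drain_drain: "0 \<le> t \<Longrightarrow> 0 \<le> r \<Longrightarrow> drain (drain x t) r = drain x (t + r)"
  by (auto simp: drain_def max_def)

lemma jump_drain_le: "jump (drain x u) y \<le> max (x - u) (1 + y)"
  by (auto simp: jump_def drain_def max_def)

lemma workload_at_arrival_Suc:
  "workload_at_arrival \<tau> s x (Suc n) =
    jump (drain (workload_at_arrival \<tau> s x n) (\<tau> (Suc n) - \<tau> n)) (s (Suc n))"
  by (simp add: Let_def Lim_segment jump_def drain_def)

declare workload_at_arrival.simps(2) [simp del]

lemma workload_path_nonneg: "0 \<le> workload_path g s x t"
  by (simp add: workload_path_def workload_def Let_def)

lemma workload_at_arrival_measurable [measurable]: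
  assumes [measurable]: "\<And>n. (\<lambda>z. \<tau> z n) \<in> borel_measurable N"
    "\<And>n. (\<lambda>z. s z n) \<in> borel_measurable N" "x \<in> borel_measurable N"
  shows "(\<lambda>z. workload_at_arrival (\<tau> z) (s z) (x z) n) \<in> borel_measurable N"
  by (induction n) (simp_all add: workload_at_arrival_Suc)

lemma workload_measurable [measurable]:
  assumes [measurable]: "\<And>n. (\<lambda>z. \<tau> z n) \<in> borel_measurable N"
    "\<And>n. (\<lambda>z. s z n) \<in> borel_measurable N" "x \<in> borel_measurable N" "t \<in> borel_measurable N"
  shows "(\<lambda>z. workload (\<tau> z) (s z) (x z) (t z)) \<in> borel_measurable N"
proof -
  have "(\<lambda>z. LEAST n. t z < \<tau> z (Suc n)) \<in> measurable N (count_space UNIV)"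
    by measurable
  then show ?thesis
    unfolding workload_def Let_def
    by (rule measurable_compose_countable[rotated]) measurable
qed

lemma workload_path_measurable [measurable]:
  assumes [measurable]: "\<And>n. (\<lambda>z. g z n) \<in> borel_measurable N"
    "\<And>n. (\<lambda>z. s z n) \<in> borel_measurable N" "x \<in> borel_measurable N" "t \<in> borel_measurable N"
  shows "(\<lambda>z. workload_path (g z) (s z) (x z) (t z)) \<in> borel_measurable N"
  unfolding workload_path_def by measurable

section \<open>Decomposition of a path at its first arrival\<close>

lemma sum_case_nat: "(\<Sum>i<Suc n. case_nat u g i) = u + (\<Sum>i<n. g i :: real)"
  by (subst sum.lessThan_Suc_shift) simp

lemma workload_at_arrival_case_nat:
  "workload_at_arrival (\<lambda>n. \<Sum>i<n. case_nat u g i) (\<lambda>n. case_nat y s (n - 1)) x (Suc n) =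
    workload_at_arrival (\<lambda>n. \<Sum>i<n. g i) (\<lambda>n. s (n - 1)) (jump (drain x u) y) n"
proof (induction n)
  case 0
  then show ?case by (simp add: workload_at_arrival_Suc)
next
  case (Suc n)
  have "workload_at_arrival (\<lambda>n. \<Sum>i<n. case_nat u g i) (\<lambda>n. case_nat y s (n - 1)) x (Suc (Suc n)) =
    jump (drain (workload_at_arrival (\<lambda>n. \<Sum>i<n. g i) (\<lambda>n. s (n - 1)) (jump (drain x u) y) n)
      ((\<Sum>i<Suc n. g i) - (\<Sum>i<n. g i))) (s n)"
    unfolding workload_at_arrival_Suc[of _ _ _ "Suc n"] Suc.IH sum_case_nat by simp
  then show ?case by (simp add: workload_at_arrival_Suc)
qed

lemma workload_path_before_arrival: "t < u \<Longrightarrow> workload_path (case_nat u g) s x t = drain x t"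
proof -
  assume "t < u"
  then have "(LEAST n. t < (\<Sum>i<Suc n. case_nat u g i)) = 0"
    by (intro Least_eq_0) simp
  then show ?thesis by (simp add: workload_path_def workload_def drain_def)
qed

text \<open>Some epoch must lie beyond \<open>t\<close>: otherwise \<open>LEAST\<close> in
  \<open>workload\<close> has no witness and does not shift by one when the first arrival is
  removed.\<close>

lemma workload_path_after_arrival:
  assumes "\<exists>n. t - u < (\<Sum>i<n. g i)" "u \<le> t"
  shows "workload_path (case_nat u g) (case_nat y s) x t = workload_path g s (jump (drain x u) y) (t - u)"
proof -
  obtain n where "t - u < (\<Sum>i<n. g i)" using assms by auto
  then have "t < (\<Sum>i<Suc n. case_nat u g i)" unfolding sum_case_nat by simp
  moreover have "\<not> t < (\<Sum>i<Suc 0. case_nat u g i)" using assms by simp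
  ultimately have "(LEAST n. t < (\<Sum>i<Suc n. case_nat u g i)) =
      Suc (LEAST n. t < (\<Sum>i<Suc (Suc n). case_nat u g i))"
    by (rule Least_Suc)
  also have "(\<lambda>n. t < (\<Sum>i<Suc (Suc n). case_nat u g i)) = (\<lambda>n. t - u < (\<Sum>i<Suc n. g i))"
    unfolding sum_case_nat by (auto simp: algebra_simps)
  finally show ?thesis
    unfolding workload_path_def workload_def Let_def
    by (simp only: workload_at_arrival_case_nat sum_case_nat)
qed

section \<open>The canonical input\<close>

locale canonical_input = G: prob_space G for G :: "real measure" +
  fixes rate :: real
  assumes rate_pos: "rate > 0" and sets_G [measurable_cong]: "sets G = sets borel"
begin

definition gap :: "real measure" where
  "gap = density lborel (exponential_density rate)"

lemma sets_gap [measurable_cong, simp]: "sets gap = sets borel"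
  by (simp add: gap_def)

lemma space_gap [simp]: "space gap = UNIV"
  by (simp add: gap_def)

lemma space_G [simp]: "space G = UNIV"
  using sets_eq_imp_space_eq[OF sets_G] by simp

sublocale gap: prob_space gap
  unfolding gap_def using rate_pos by (rule prob_space_exponential_density)

sublocale gaps: sequence_space gap ..
sublocale services: sequence_space G ..

definition input :: "((nat \<Rightarrow> real) \<times> (nat \<Rightarrow> real)) measure" where
  "input = gaps.S \<Otimes>\<^sub>M services.S"

lemma sets_input [measurable_cong]: "sets input = sets (gaps.S \<Otimes>\<^sub>M services.S)"
  by (simp add: input_def)

sublocale GS: pair_prob_space gaps.S services.S ..

sublocale input: prob_space input
  unfolding input_def by (rule GS.P.prob_space_axioms)

lemma nn_integral_gaps:
  assumes [measurable]: "h \<in> borel_measurable gaps.S"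
  shows "(\<integral>\<^sup>+g. h g \<partial>gaps.S) = (\<integral>\<^sup>+u. \<integral>\<^sup>+g. h (case_nat u g) \<partial>gaps.S \<partial>gap)"
  by (subst gaps.PiM_iter[symmetric])
    (simp add: nn_integral_distr gaps.nn_integral_fst[symmetric] split_beta')

lemma nn_integral_services:
  assumes [measurable]: "h \<in> borel_measurable services.S"
  shows "(\<integral>\<^sup>+g. h g \<partial>services.S) = (\<integral>\<^sup>+u. \<integral>\<^sup>+g. h (case_nat u g) \<partial>services.S \<partial>G)"
  by (subst services.PiM_iter[symmetric])
    (simp add: nn_integral_distr services.nn_integral_fst[symmetric] split_beta')

text \<open>Regeneration at the first arrival: what remains of the input after its first gap and
  first service is a fresh input independent of both. Fubini is needed to move the first service in
  front of the remaining gaps.\<close>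

lemma nn_integral_input:
  assumes [measurable]: "h \<in> borel_measurable (gaps.S \<Otimes>\<^sub>M services.S)"
  shows "(\<integral>\<^sup>+w. h w \<partial>input) =
    (\<integral>\<^sup>+u. \<integral>\<^sup>+y. \<integral>\<^sup>+w. h (case_nat u (fst w), case_nat y (snd w)) \<partial>input \<partial>G \<partial>gap)"
proof -
  have "(\<integral>\<^sup>+w. h w \<partial>input) = (\<integral>\<^sup>+g. \<integral>\<^sup>+s. h (g, s) \<partial>services.S \<partial>gaps.S)"
    unfolding input_def by (rule services.nn_integral_fst[symmetric]) measurable
  also have "\<dots> = (\<integral>\<^sup>+u. \<integral>\<^sup>+g. \<integral>\<^sup>+s. h (case_nat u g, s) \<partial>services.S \<partial>gaps.S \<partial>gap)"
    by (rule nn_integral_gaps) measurable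
  also have "\<dots> = (\<integral>\<^sup>+u. \<integral>\<^sup>+g. \<integral>\<^sup>+y. \<integral>\<^sup>+s. h (case_nat u g, case_nat y s) \<partial>services.S \<partial>G \<partial>gaps.S \<partial>gap)"
    by (intro nn_integral_cong nn_integral_services) measurable
  also have "\<dots> = (\<integral>\<^sup>+u. \<integral>\<^sup>+y. \<integral>\<^sup>+g. \<integral>\<^sup>+s. h (case_nat u g, case_nat y s) \<partial>services.S \<partial>gaps.S \<partial>G \<partial>gap)"
  proof (intro nn_integral_cong)
    fix u assume "u \<in> space gap"
    interpret pair_sigma_finite G gaps.S ..
    show "(\<integral>\<^sup>+g. \<integral>\<^sup>+y. \<integral>\<^sup>+s. h (case_nat u g, case_nat y s) \<partial>services.S \<partial>G \<partial>gaps.S) =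
        (\<integral>\<^sup>+y. \<integral>\<^sup>+g. \<integral>\<^sup>+s. h (case_nat u g, case_nat y s) \<partial>services.S \<partial>gaps.S \<partial>G)"
      by (rule Fubini') measurable
  qed
  also have "\<dots> = (\<integral>\<^sup>+u. \<integral>\<^sup>+y. \<integral>\<^sup>+w. h (case_nat u (fst w), case_nat y (snd w)) \<partial>input \<partial>G \<partial>gap)"
    unfolding input_def
    by (intro nn_integral_cong) (subst services.nn_integral_fst[symmetric]; simp)
  finally show ?thesis .
qed

section \<open>The renewal equation\<close>

lemma nn_integral_gap:
  assumes [measurable]: "h \<in> borel_measurable borel"
  shows "(\<integral>\<^sup>+u. h u \<partial>gap) = (\<integral>\<^sup>+u. ennreal (rate * exp (- rate * u)) * h u * indicator {0..} u \<partial>lborel)"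
  unfolding gap_def
  by (subst nn_integral_density)
    (auto intro!: nn_integral_cong simp: exponential_density_def mult_ac split: split_indicator)

text \<open>The fundamental theorem of calculus as a verification rule: an integral over a gap is
  bounded by guessing a decreasing \<psi> whose rate of decrease dominates the integrand. The bound
  telescopes with whatever is known about \<open>\<psi> a\<close>.\<close>

lemma nn_integral_gap_le:
  assumes [measurable]: "h \<in> borel_measurable borel" "\<psi>' \<in> borel_measurable borel"
    and a: "0 \<le> a"
    and deriv: "\<And>u. 0 \<le> u \<Longrightarrow> u \<le> a \<Longrightarrow> (\<psi> has_real_derivative - \<psi>' u) (at u)"
    and nonneg: "\<And>u. 0 \<le> u \<Longrightarrow> u \<le> a \<Longrightarrow> 0 \<le> \<psi>' u"
    and le: "\<And>u. 0 \<le> u \<Longrightarrow> u \<le> a \<Longrightarrow> ennreal (rate * exp (- rate * u)) * h u \<le> ennreal (\<psi>' u)"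
  shows "(\<integral>\<^sup>+u. h u * indicator {..a} u \<partial>gap) \<le> ennreal (\<psi> 0 - \<psi> a)"
proof -
  have "(\<integral>\<^sup>+u. h u * indicator {..a} u \<partial>gap) \<le> (\<integral>\<^sup>+u. ennreal (\<psi>' u) * indicator {0..a} u \<partial>lborel)"
    using le by (subst nn_integral_gap) (auto intro!: nn_integral_mono split: split_indicator simp: mult_ac)
  also have "\<dots> = ennreal ((- \<psi> a) - (- \<psi> 0))"
    using a deriv nonneg
    by (intro nn_integral_FTC_Icc) (auto intro!: derivative_eq_intros)
  finally show ?thesis by simp
qed

lemma nn_integral_gap_memoryless:
  assumes [measurable]: "h \<in> borel_measurable borel" and t: "0 \<le> t"
  shows "(\<integral>\<^sup>+u. h (u - t) * indicator {t<..} u \<partial>gap) = ennreal (exp (- rate * t)) * (\<integral>\<^sup>+u. h u \<partial>gap)"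
proof -
  have "(\<integral>\<^sup>+u. h (u - t) * indicator {t<..} u \<partial>gap) =
      (\<integral>\<^sup>+u. ennreal (rate * exp (- rate * u)) * (h (u - t) * indicator {t<..} u) * indicator {0..} u \<partial>lborel)"
    by (rule nn_integral_gap) measurable
  also have "\<dots> = (\<integral>\<^sup>+u. ennreal (rate * exp (- rate * (t + u))) * (h u * indicator {t<..} (t + u)) * indicator {0..} (t + u) \<partial>lborel)"
    by (subst nn_integral_real_affine[where c = 1 and t = t]) (auto simp del: ennreal_mult')
  also have "\<dots> = (\<integral>\<^sup>+u. ennreal (exp (- rate * t)) * (ennreal (rate * exp (- rate * u)) * h u * indicator {0..} u) \<partial>lborel)"
  proof (rule nn_integral_cong_AE)
    \<comment> \<open>The integrands differ at \<open>u = 0\<close>, where the shifted open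
      half-line excludes a point that \<open>{0..}\<close> contains.\<close>
    have "AE u in lborel. u \<noteq> (0::real)" by (rule AE_lborel_singleton)
    then show "AE u in lborel. ennreal (rate * exp (- rate * (t + u))) * (h u * indicator {t<..} (t + u)) * indicator {0..} (t + u)
      = ennreal (exp (- rate * t)) * (ennreal (rate * exp (- rate * u)) * h u * indicator {0..} u)"
    proof eventually_elim
      case (elim u)
      have "rate * exp (- rate * (t + u)) = exp (- rate * t) * (rate * exp (- rate * u))"
        by (simp add: exp_add[symmetric] algebra_simps)
      then have "ennreal (rate * exp (- rate * (t + u))) = ennreal (exp (- rate * t)) * ennreal (rate * exp (- rate * u))"
        using rate_pos by (simp add: ennreal_mult mult_ac)
      then show ?case using elim t by (auto split: split_indicator simp: mult_ac)
    qed
  qed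
  also have "\<dots> = ennreal (exp (- rate * t)) * (\<integral>\<^sup>+u. h u \<partial>gap)"
    by (subst nn_integral_gap) (auto intro!: nn_integral_cmult)
  finally show ?thesis .
qed

text \<open>The renewal operator: \<open>\<sigma> u y z\<close> is the state after a first arrival
  at time \<open>u\<close> with service \<open>y\<close>. The state type is left open because the
  operator acts on single workloads, on pairs and on a one-point space.\<close>

definition arrivals :: "(real \<Rightarrow> real \<Rightarrow> 'z \<Rightarrow> 'z) \<Rightarrow> (real \<Rightarrow> 'z \<Rightarrow> ennreal) \<Rightarrow> real \<Rightarrow> 'z \<Rightarrow> ennreal" where
  "arrivals \<sigma> F t z = (\<integral>\<^sup>+u. (\<integral>\<^sup>+y. F (t - u) (\<sigma> u y z) \<partial>G) * indicator {..t} u \<partial>gap)"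

text \<open>The excess of a bounded subsolution over a supersolution is itself a subsolution without
  inhomogeneous term, and each application of the renewal operator halves the bound on it.
  Measurability of \<open>H\<close> serves to separate \<open>H\<close> from the error under the
  integral.\<close>

lemma comparison:
  fixes F H :: "real \<Rightarrow> 'z \<Rightarrow> ennreal"
  assumes bounded: "\<And>t z. 0 \<le> t \<Longrightarrow> F t z \<le> ennreal c"
    and sub: "\<And>t z. 0 \<le> t \<Longrightarrow> F t z \<le> b t z + arrivals \<sigma> F t z"
    and super: "\<And>t z. 0 \<le> t \<Longrightarrow> b t z + arrivals \<sigma> H t z \<le> H t z"
    and meas: "\<And>t z. (\<lambda>(u, y). H (t - u) (\<sigma> u y z)) \<in> borel_measurable (gap \<Otimes>\<^sub>M G)"
    and "0 \<le> t"
  shows "F t z \<le> H t z"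
proof -
  \<comment> \<open>In the weight \<open>exp (rate * t)\<close> the operator contracts by 1/2:
    \<open>rate * exp (- rate * u) * exp (rate * (t - u))\<close> equals
    \<open>rate * exp (rate * t) * exp (- 2 * rate * u)\<close>, whose integral over
    \<open>u\<close> is at most half the weight.\<close>
  define e where "e n t = max c 0 * (1/2) ^ n * exp (rate * t)" for n :: nat and t
  have e_meas [measurable]: "e n \<in> borel_measurable borel" for n
    unfolding e_def by measurable
  have e_nonneg: "0 \<le> e n t" for n t by (simp add: e_def)
  have "F t z \<le> H t z + ennreal (e n t)" if "0 \<le> t" for n t z
    using that
  proof (induction n arbitrary: t z)
    case 0
    have "c \<le> max c 0 * 1" by simp
    also have "\<dots> \<le> max c 0 * exp (rate * t)"
      using 0 rate_pos by (intro mult_left_mono) auto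
    finally have "ennreal c \<le> ennreal (e 0 t)" by (intro ennreal_leI) (simp add: e_def)
    with bounded[OF 0, of z] show ?case by (meson add_increasing order_trans zero_le)
  next
    case (Suc n)
    have H_meas [measurable]: "(\<lambda>(u, y). H (t - u) (\<sigma> u y z)) \<in> borel_measurable (gap \<Otimes>\<^sub>M G)" by (rule meas)
    have sec: "(\<lambda>y. H (t - u) (\<sigma> u y z)) \<in> borel_measurable G" for u
      using measurable_Pair2[OF H_meas, of u] by simp
    have "arrivals \<sigma> F t z \<le>
      (\<integral>\<^sup>+u. (\<integral>\<^sup>+y. H (t - u) (\<sigma> u y z) \<partial>G) * indicator {..t} u + ennreal (e n (t - u)) * indicator {..t} u \<partial>gap)"
      unfolding arrivals_def
    proof (intro nn_integral_mono)
      fix u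
      show "(\<integral>\<^sup>+y. F (t - u) (\<sigma> u y z) \<partial>G) * indicator {..t} u \<le>
        (\<integral>\<^sup>+y. H (t - u) (\<sigma> u y z) \<partial>G) * indicator {..t} u + ennreal (e n (t - u)) * indicator {..t} u"
      proof (cases "u \<le> t")
        case True
        then have "(\<integral>\<^sup>+y. F (t - u) (\<sigma> u y z) \<partial>G) \<le> (\<integral>\<^sup>+y. H (t - u) (\<sigma> u y z) + ennreal (e n (t - u)) \<partial>G)"
          by (intro nn_integral_mono Suc.IH) simp
        also have "\<dots> = (\<integral>\<^sup>+y. H (t - u) (\<sigma> u y z) \<partial>G) + ennreal (e n (t - u))"
          using sec by (subst nn_integral_add) (auto simp: G.emeasure_space_1[unfolded space_G])
        finally show ?thesis using True by simp
      qed simp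
    qed
    also have "\<dots> = arrivals \<sigma> H t z + (\<integral>\<^sup>+u. ennreal (e n (t - u)) * indicator {..t} u \<partial>gap)"
      unfolding arrivals_def
      by (rule nn_integral_add) measurable
    also have "(\<integral>\<^sup>+u. ennreal (e n (t - u)) * indicator {..t} u \<partial>gap) \<le>
        ennreal (e (Suc n) t * exp (- 2 * rate * 0) - e (Suc n) t * exp (- 2 * rate * t))"
    proof (rule nn_integral_gap_le[where \<psi>' = "\<lambda>u. 2 * rate * e (Suc n) t * exp (- 2 * rate * u)"])
      fix u
      show "((\<lambda>u. e (Suc n) t * exp (- 2 * rate * u)) has_real_derivative - (2 * rate * e (Suc n) t * exp (- 2 * rate * u))) (at u)"
        by (auto intro!: derivative_eq_intros)
      have "rate * exp (- rate * u) * e n (t - u) = 2 * rate * e (Suc n) t * exp (- 2 * rate * u)"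
        by (simp add: e_def exp_add[symmetric] algebra_simps flip: exp_add)
      then show "ennreal (rate * exp (- rate * u)) * ennreal (e n (t - u)) \<le> ennreal (2 * rate * e (Suc n) t * exp (- 2 * rate * u))"
        using rate_pos e_nonneg by (subst ennreal_mult[symmetric]) auto
    qed (use Suc.prems rate_pos e_nonneg in auto)
    also have "\<dots> \<le> ennreal (e (Suc n) t)"
      using e_nonneg by (intro ennreal_leI) simp
    finally have "b t z + arrivals \<sigma> F t z \<le> b t z + arrivals \<sigma> H t z + ennreal (e (Suc n) t)"
      by (simp add: add.assoc add_left_mono)
    also have "\<dots> \<le> H t z + ennreal (e (Suc n) t)"
      by (intro add_right_mono super Suc.prems)
    finally show ?case using sub[OF Suc.prems, of z] by (rule order_trans[rotated])
  qed
  moreover have "(\<lambda>n. H t z + ennreal (e n t)) \<longlonglongrightarrow> H t z + ennreal (max c 0 * 0 * exp (rate * t))"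
    unfolding e_def by (intro tendsto_intros LIMSEQ_power_zero) simp_all
  ultimately show ?thesis
    using \<open>0 \<le> t\<close> by (intro LIMSEQ_le_const[where X = "\<lambda>n. H t z + ennreal (e n t)"]) auto
qed

text \<open>If all epochs stay below \<open>t\<close>, then the first gap is at most
  \<open>t\<close> and all later sums stay below the remaining time. The probability of this event
  therefore satisfies a renewal inequality without inhomogeneous term, and the zero function is a
  supersolution. Integer \<open>t\<close> suffice for the almost sure statement.\<close>

lemma AE_finitely_many_arrivals: "AE w in input. \<forall>t. \<exists>n. t < (\<Sum>i<n. fst w i)"
proof -
  define F :: "real \<Rightarrow> unit \<Rightarrow> ennreal"
    where "F t z = (\<integral>\<^sup>+w. indicator {w. \<forall>n. (\<Sum>i<n. fst w i) \<le> t} w \<partial>input)" for t z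
  have "F t () \<le> 0" if "0 \<le> t" for t
  proof (rule comparison[where F = F and H = "\<lambda>_ _. 0" and c = 1 and b = "\<lambda>_ _. 0" and \<sigma> = "\<lambda>_ _ z. z"])
    fix t :: real and z
    assume "0 \<le> t"
    have "F t z \<le> (\<integral>\<^sup>+w. 1 \<partial>input)"
      unfolding F_def by (intro nn_integral_mono) (simp split: split_indicator)
    then show "F t z \<le> ennreal 1" by (simp add: input.emeasure_space_1)
    have "F t z = (\<integral>\<^sup>+u. \<integral>\<^sup>+y. \<integral>\<^sup>+w. indicator {w. \<forall>n. (\<Sum>i<n. fst w i) \<le> t}
        (case_nat u (fst w), case_nat y (snd w)) \<partial>input \<partial>G \<partial>gap)"
      unfolding F_def by (rule nn_integral_input) measurable
    also have "\<dots> \<le> (\<integral>\<^sup>+u. \<integral>\<^sup>+y. F (t - u) z * indicator {..t} u \<partial>G \<partial>gap)"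
    proof (intro nn_integral_mono)
      fix u y :: real
      have "indicator {w. \<forall>n. (\<Sum>i<n. fst w i) \<le> t} (case_nat u (fst w), case_nat y (snd w)) \<le>
        (indicator {w. \<forall>n. (\<Sum>i<n. fst w i) \<le> t - u} w * indicator {..t} u :: ennreal)" for w
      proof (cases "\<forall>n. (\<Sum>i<n. case_nat u (fst w) i) \<le> t")
        case True
        then have *: "(\<Sum>i<Suc n. case_nat u (fst w) i) \<le> t" for n by blast
        have "(\<Sum>i<n. fst w i) \<le> t - u" for n
          using *[of n] unfolding sum_case_nat by simp
        moreover have "u \<le> t" using *[of 0] by simp
        ultimately show ?thesis by (simp split: split_indicator)
      qed simp
      then have "(\<integral>\<^sup>+w. indicator {w. \<forall>n. (\<Sum>i<n. fst w i) \<le> t} (case_nat u (fst w), case_nat y (snd w)) \<partial>input) \<le>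
          (\<integral>\<^sup>+w. indicator {w. \<forall>n. (\<Sum>i<n. fst w i) \<le> t - u} w * indicator {..t} u \<partial>input)"
        by (intro nn_integral_mono)
      also have "\<dots> = F (t - u) z * indicator {..t} u"
        unfolding F_def by (rule nn_integral_multc) measurable
      finally show "(\<integral>\<^sup>+w. indicator {w. \<forall>n. (\<Sum>i<n. fst w i) \<le> t} (case_nat u (fst w), case_nat y (snd w)) \<partial>input) \<le>
          F (t - u) z * indicator {..t} u" .
    qed
    also have "\<dots> = arrivals (\<lambda>_ _ z. z) F t z"
      unfolding arrivals_def by (simp add: G.emeasure_space_1[unfolded space_G])
    finally show "F t z \<le> 0 + arrivals (\<lambda>_ _ z. z) F t z" by simp
  qed (use that in \<open>auto simp: arrivals_def\<close>)
  then have zero: "F (real k) () = 0" for k by simp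
  have "AE w in input. \<exists>n. real k < (\<Sum>i<n. fst w i)" for k
  proof -
    have "AE w in input. indicator {w. \<forall>n. (\<Sum>i<n. fst w i) \<le> real k} w = (0::ennreal)"
      using zero[of k] unfolding F_def by (subst (asm) nn_integral_0_iff_AE) measurable
    then show ?thesis by eventually_elim (auto simp: not_le split: split_indicator_asm)
  qed
  then have "AE w in input. \<forall>k. \<exists>n. real k < (\<Sum>i<n. fst w i)"
    by (simp add: AE_all_countable)
  then show ?thesis
  proof eventually_elim
    case (elim w)
    show ?case
    proof
      fix t :: real
      obtain k where "t < real k" using reals_Archimedean2 by blast
      with elim show "\<exists>n. t < (\<Sum>i<n. fst w i)" by (meson less_trans)
    qed
  qed
qed

section \<open>The transition semigroup of the workload\<close>

definition expect :: "(real \<Rightarrow> ennreal) \<Rightarrow> real \<Rightarrow> real \<Rightarrow> ennreal" where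
  "expect f t x = (\<integral>\<^sup>+w. f (workload_path (fst w) (snd w) x t) \<partial>input)"

lemma expect_measurable [measurable]:
  assumes [measurable]: "f \<in> borel_measurable borel" "t \<in> borel_measurable N" "x \<in> borel_measurable N"
  shows "(\<lambda>z. expect f (t z) (x z)) \<in> borel_measurable N"
  unfolding expect_def by measurable

lemma expect_mono: "(\<And>x. f x \<le> f' x) \<Longrightarrow> expect f t x \<le> expect f' t x"
  unfolding expect_def by (intro nn_integral_mono) blast

lemma expect_const [simp]: "expect (\<lambda>_. c) t x = c"
  by (simp add: expect_def input.emeasure_space_1)

lemma expect_le: "(\<And>x. f x \<le> c) \<Longrightarrow> expect f t x \<le> c"
  using expect_mono[of f "\<lambda>_. c"] by simp

lemma expect_first_arrival:
  assumes [measurable]: "f \<in> borel_measurable borel"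
  shows "expect f t x = (\<integral>\<^sup>+u. (if t < u then f (drain x t)
      else \<integral>\<^sup>+y. expect f (t - u) (jump (drain x u) y) \<partial>G) \<partial>gap)"
proof -
  have "expect f t x = (\<integral>\<^sup>+u. \<integral>\<^sup>+y. \<integral>\<^sup>+w. f (workload_path (case_nat u (fst w)) (case_nat y (snd w)) x t) \<partial>input \<partial>G \<partial>gap)"
    unfolding expect_def by (subst nn_integral_input) simp_all
  also have "\<dots> = (\<integral>\<^sup>+u. (if t < u then f (drain x t)
      else \<integral>\<^sup>+y. expect f (t - u) (jump (drain x u) y) \<partial>G) \<partial>gap)"
  proof (intro nn_integral_cong)
    fix u
    show "(\<integral>\<^sup>+y. \<integral>\<^sup>+w. f (workload_path (case_nat u (fst w)) (case_nat y (snd w)) x t) \<partial>input \<partial>G) =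
      (if t < u then f (drain x t) else \<integral>\<^sup>+y. expect f (t - u) (jump (drain x u) y) \<partial>G)"
    proof (cases "t < u")
      case True
      then show ?thesis
        by (simp add: workload_path_before_arrival input.emeasure_space_1 G.emeasure_space_1[unfolded space_G])
    next
      case False
      \<comment> \<open>Restarting the path at the first arrival is legitimate only when the later
        epochs are unbounded, so non-explosion enters here.\<close>
      have "AE w in input. f (workload_path (case_nat u (fst w)) (case_nat y (snd w)) x t) =
          f (workload_path (fst w) (snd w) (jump (drain x u) y) (t - u))" for y
        using AE_finitely_many_arrivals
        by eventually_elim (use False in \<open>simp add: workload_path_after_arrival\<close>)
      then show ?thesis
        using False unfolding expect_def by (auto intro!: nn_integral_cong nn_integral_cong_AE)
    qed
  qed
  finally show ?thesis .
qed

text \<open>The first gap is almost surely positive. The value is taken at \<open>drain x 0\<close>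
  rather than \<open>x\<close> because starting points may be negative, and \<open>workload\<close>
  cuts them off at 0.\<close>

lemma expect_zero:
  assumes [measurable]: "f \<in> borel_measurable borel"
  shows "expect f 0 x = f (drain x 0)"
proof -
  have "AE u in gap. 0 < u"
  proof -
    have "AE u in lborel. u \<noteq> (0::real)" by (rule AE_lborel_singleton)
    then have "AE u in lborel. 0 < ennreal (exponential_density rate u) \<longrightarrow> 0 < u"
      by eventually_elim (auto simp: exponential_density_def)
    then show ?thesis unfolding gap_def by (subst AE_density) simp_all
  qed
  then have "expect f 0 x = (\<integral>\<^sup>+u. f (drain x 0) \<partial>gap)"
    by (subst expect_first_arrival[OF assms], intro nn_integral_cong_AE) (auto elim: eventually_mono)
  then show ?thesis by (simp add: gap.emeasure_space_1[unfolded space_gap])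
qed

text \<open>If no arrival occurs before \<open>t\<close>, memorylessness makes the rest of the gap a
  fresh one and the process restarts from the drained state. If one occurs at \<open>u\<close>, the
  time \<open>t - u + r\<close> is left. With \<open>r\<close> fixed this is a renewal equation in
  \<open>t\<close>, which is what the semigroup property needs.\<close>

lemma expect_split:
  assumes f [measurable]: "f \<in> borel_measurable borel" and "0 \<le> t" "0 \<le> r"
  shows "expect f (t + r) x = ennreal (exp (- rate * t)) * expect f r (drain x t) +
    arrivals (\<lambda>u y x. jump (drain x u) y) (\<lambda>s. expect f (s + r)) t x"
proof -
  let ?h = "\<lambda>t x u. if t < u then f (drain x t) else \<integral>\<^sup>+y. expect f (t - u) (jump (drain x u) y) \<partial>G"
  have "expect f (t + r) x = (\<integral>\<^sup>+u. ?h (t + r) x u \<partial>gap)"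
    by (rule expect_first_arrival[OF f])
  also have "\<dots> = (\<integral>\<^sup>+u. ?h r (drain x t) (u - t) * indicator {t<..} u +
      (\<integral>\<^sup>+y. expect f (t - u + r) (jump (drain x u) y) \<partial>G) * indicator {..t} u \<partial>gap)"
    using assms
    by (intro nn_integral_cong) (auto simp: drain_drain algebra_simps split: split_indicator)
  also have "\<dots> = (\<integral>\<^sup>+u. ?h r (drain x t) (u - t) * indicator {t<..} u \<partial>gap) +
      arrivals (\<lambda>u y x. jump (drain x u) y) (\<lambda>s. expect f (s + r)) t x"
    unfolding arrivals_def by (rule nn_integral_add) measurable
  also have "(\<integral>\<^sup>+u. ?h r (drain x t) (u - t) * indicator {t<..} u \<partial>gap) =
      ennreal (exp (- rate * t)) * (\<integral>\<^sup>+u. ?h r (drain x t) u \<partial>gap)"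
    using assms by (intro nn_integral_gap_memoryless) measurable
  also have "(\<integral>\<^sup>+u. ?h r (drain x t) u \<partial>gap) = expect f r (drain x t)"
    by (rule expect_first_arrival[OF f, symmetric])
  finally show ?thesis .
qed

lemma expect_renewal:
  assumes [measurable]: "f \<in> borel_measurable borel" and "0 \<le> t"
  shows "expect f t x = ennreal (exp (- rate * t)) * f (drain x t) +
    arrivals (\<lambda>u y x. jump (drain x u) y) (expect f) t x"
  using expect_split[of f t 0 x] expect_zero[of f "drain x t"] assms by (simp add: drain_drain)

text \<open>Both sides solve the same renewal equation.\<close>
lemma chapman_kolmogorov:
  assumes [measurable]: "f \<in> borel_measurable borel" and f: "\<And>x. f x \<le> 1" and t: "0 \<le> t" and r: "0 \<le> r"
  shows "expect f (t + r) x = expect (expect f r) t x"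
proof (rule antisym)
  let ?b = "\<lambda>t x. ennreal (exp (- rate * t)) * expect f r (drain x t)"
  let ?\<sigma> = "\<lambda>u y x. jump (drain x u) y"
  have bound: "expect f s z \<le> ennreal 1" "expect (expect f r) s z \<le> ennreal 1" for s z
    by (auto intro!: expect_le f)
  have eq: "expect f (t + r) x = ?b t x + arrivals ?\<sigma> (\<lambda>s. expect f (s + r)) t x"
      "expect (expect f r) t x = ?b t x + arrivals ?\<sigma> (expect (expect f r)) t x" if "0 \<le> t" for t x
    using expect_split[OF assms(1) that r] expect_renewal[OF _ that, of "expect f r"] by simp_all
  show "expect f (t + r) x \<le> expect (expect f r) t x"
    by (rule comparison[where F = "\<lambda>t. expect f (t + r)" and H = "expect (expect f r)" and \<sigma> = ?\<sigma>,
          OF bound(1) eq_refl[OF eq(1)] eq_refl[OF eq(2)[symmetric]] _ t]) measurable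
  show "expect (expect f r) t x \<le> expect f (t + r) x"
    by (rule comparison[where H = "\<lambda>t. expect f (t + r)" and F = "expect (expect f r)" and \<sigma> = ?\<sigma>,
          OF bound(2) eq_refl[OF eq(2)] eq_refl[OF eq(1)[symmetric]] _ t]) measurable
qed

section \<open>Exponential moments\<close>

lemma nn_integral_G_le:
  assumes "integrable G h" "\<And>y. 0 \<le> h y" "\<And>y. F y \<le> ennreal (h y)" "(\<integral>y. h y \<partial>G) = c"
  shows "(\<integral>\<^sup>+y. F y \<partial>G) \<le> ennreal c"
proof -
  have "(\<integral>\<^sup>+y. F y \<partial>G) \<le> (\<integral>\<^sup>+y. ennreal (h y) \<partial>G)"
    using assms by (intro nn_integral_mono) auto
  also have "\<dots> = ennreal c"
    using assms by (subst nn_integral_eq_integral) auto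
  finally show ?thesis .
qed

text \<open>
  An accepted service leaves at most \<open>1 + y\<close> work, so \<open>H\<close> below is the exponential moment of a
  system in which every arrival brings an extra customer who departs after \<open>1 + y\<close>.
\<close>
lemma exponential_moment_truncated:
  fixes k :: real
  assumes \<epsilon>: "0 < \<epsilon>" and int: "integrable G (\<lambda>y. exp (\<epsilon> * y))" and t: "0 \<le> t" and k: "0 \<le> k"
  defines "m \<equiv> (\<integral>y. exp (\<epsilon> * (1 + y)) \<partial>G)"
  shows "expect (\<lambda>v. ennreal (min (exp (\<epsilon> * v)) k)) t x \<le> ennreal (1 + exp (\<epsilon> * (x - t)) + rate * m / \<epsilon>)"
proof -
  define B where "B = rate * m / \<epsilon>"
  have int': "integrable G (\<lambda>y. exp (\<epsilon> * (1 + y)))"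
    using int by (simp add: distrib_left exp_add)
  have m0: "0 \<le> m" unfolding m_def by simp
  have B0: "0 \<le> B" and Be: "B * \<epsilon> = rate * m" using m0 rate_pos \<epsilon> by (auto simp: B_def)
  let ?f = "\<lambda>v. ennreal (min (exp (\<epsilon> * v)) k)"
  let ?\<sigma> = "\<lambda>u y x. jump (drain x u) y"
  \<comment> \<open>The 1 covers an emptied system, the second term the initial work. An extra
    customer of age \<open>s\<close> contributes \<open>m * exp (- \<epsilon> * s)\<close> on
    average; arrivals at rate \<open>rate\<close> during time \<open>t\<close> integrate this to the
    last term, with \<open>B = rate * m / \<epsilon>\<close>.\<close>
  define H where "H t x = ennreal (1 + exp (\<epsilon> * (x - t)) + B * (1 - exp (- \<epsilon> * t)))" for t x
  have H_meas [measurable]: "(\<lambda>z. H (p z) (q z)) \<in> borel_measurable N"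
    if [measurable]: "p \<in> borel_measurable N" "q \<in> borel_measurable N" for p q and N :: "'c measure"
    unfolding H_def by measurable
  have "expect ?f t x \<le> H t x"
  proof (rule comparison[where F = "expect ?f" and \<sigma> = ?\<sigma> and c = k
        and b = "\<lambda>t x. ennreal (exp (- rate * t)) * ?f (drain x t)"])
    fix t x :: real assume t: "0 \<le> t"
    show "expect ?f t x \<le> ennreal k" by (intro expect_le ennreal_leI) simp
    show "expect ?f t x \<le> ennreal (exp (- rate * t)) * ?f (drain x t) + arrivals ?\<sigma> (expect ?f) t x"
      using expect_renewal[of ?f t x] t by simp
    \<comment> \<open>This is \<open>exp (- rate * u) * H (t - u) (x - u)\<close>, written without
      \<open>ennreal\<close>. Since \<open>B * \<epsilon> = rate * m\<close>, its rate of decrease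
      is exactly the bound on the arrival integrand. Its value at \<open>t\<close> bounds the term
      without arrivals, and its value at 0 is \<open>H t x\<close>.\<close>
    define \<psi> where "\<psi> u = exp (- rate * u) * (1 + exp (\<epsilon> * (x - t)) + B * (1 - exp (- \<epsilon> * (t - u))))" for u
    define \<psi>' where "\<psi>' u = rate * exp (- rate * u) *
      (1 + exp (\<epsilon> * (x - t)) + exp (- \<epsilon> * (t - u)) * m + B * (1 - exp (- \<epsilon> * (t - u))))" for u
    have "arrivals ?\<sigma> H t x \<le> ennreal (\<psi> 0 - \<psi> t)"
      unfolding arrivals_def
    proof (rule nn_integral_gap_le)
      fix u assume u: "0 \<le> u" "u \<le> t"
      have *: "\<epsilon> * (B * X) = rate * m * X" for X using Be by (metis mult.assoc mult.commute)
      show "(\<psi> has_real_derivative - \<psi>' u) (at u)"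
        unfolding \<psi>_def \<psi>'_def
        by (auto intro!: derivative_eq_intros simp: algebra_simps * Be)
      have nonneg: "0 \<le> B * (1 - exp (- \<epsilon> * (t - u)))"
        using B0 \<epsilon> u by (intro mult_nonneg_nonneg) auto
      then show "0 \<le> \<psi>' u"
        unfolding \<psi>'_def using rate_pos m0 nonneg
        by (intro mult_nonneg_nonneg[of "rate * exp (- rate * u)"] add_nonneg_nonneg) (assumption | simp)+
      have "(\<integral>\<^sup>+y. H (t - u) (?\<sigma> u y x) \<partial>G) \<le>
          ennreal (1 + exp (\<epsilon> * (x - t)) + exp (- \<epsilon> * (t - u)) * m + B * (1 - exp (- \<epsilon> * (t - u))))"
      proof (rule nn_integral_G_le[where h = "\<lambda>y. 1 + exp (\<epsilon> * (x - t)) +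
            exp (- \<epsilon> * (t - u)) * exp (\<epsilon> * (1 + y)) + B * (1 - exp (- \<epsilon> * (t - u)))"])
        fix y
        show "0 \<le> 1 + exp (\<epsilon> * (x - t)) + exp (- \<epsilon> * (t - u)) * exp (\<epsilon> * (1 + y)) + B * (1 - exp (- \<epsilon> * (t - u)))"
          using nonneg by (intro add_nonneg_nonneg) auto
        have "exp (\<epsilon> * ?\<sigma> u y x) \<le> exp (\<epsilon> * (x - u)) + exp (\<epsilon> * (1 + y))"
        proof -
          have "exp (\<epsilon> * ?\<sigma> u y x) \<le> exp (\<epsilon> * max (x - u) (1 + y))"
            using \<epsilon> jump_drain_le[of x u y] by simp
          also have "\<dots> \<le> exp (\<epsilon> * (x - u)) + exp (\<epsilon> * (1 + y))"
            by (simp add: max_def add_increasing add_increasing2)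
          finally show ?thesis .
        qed
        then have "exp (- \<epsilon> * (t - u)) * exp (\<epsilon> * ?\<sigma> u y x) \<le>
            exp (- \<epsilon> * (t - u)) * (exp (\<epsilon> * (x - u)) + exp (\<epsilon> * (1 + y)))"
          by (intro mult_left_mono) auto
        moreover have "exp (- \<epsilon> * (t - u)) * exp (\<epsilon> * ?\<sigma> u y x) = exp (\<epsilon> * (?\<sigma> u y x - (t - u)))"
          by (simp add: exp_add[symmetric] algebra_simps)
        moreover have "exp (- \<epsilon> * (t - u)) * exp (\<epsilon> * (x - u)) = exp (\<epsilon> * (x - t))"
          by (simp add: exp_add[symmetric] algebra_simps)
        ultimately show "H (t - u) (?\<sigma> u y x) \<le> ennreal (1 + exp (\<epsilon> * (x - t)) +
            exp (- \<epsilon> * (t - u)) * exp (\<epsilon> * (1 + y)) + B * (1 - exp (- \<epsilon> * (t - u))))"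
          unfolding H_def by (intro ennreal_leI) (simp add: distrib_left)
      qed (use int' in \<open>auto simp: m_def G.prob_space[unfolded space_G]\<close>)
      then have "ennreal (rate * exp (- rate * u)) * (\<integral>\<^sup>+y. H (t - u) (?\<sigma> u y x) \<partial>G) \<le>
        ennreal (rate * exp (- rate * u)) *
          ennreal (1 + exp (\<epsilon> * (x - t)) + exp (- \<epsilon> * (t - u)) * m + B * (1 - exp (- \<epsilon> * (t - u))))"
        by (intro mult_left_mono) auto
      also have "\<dots> = ennreal (\<psi>' u)"
        unfolding \<psi>'_def using rate_pos by (subst ennreal_mult') auto
      finally show "ennreal (rate * exp (- rate * u)) * (\<integral>\<^sup>+y. H (t - u) (?\<sigma> u y x) \<partial>G) \<le> ennreal (\<psi>' u)" .
    qed (use t in \<open>auto simp: \<psi>'_def\<close>)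
    moreover have "ennreal (exp (- rate * t)) * ?f (drain x t) \<le> ennreal (\<psi> t)"
    proof -
      have "min (exp (\<epsilon> * drain x t)) k \<le> 1 + exp (\<epsilon> * (x - t))"
        by (rule min.coboundedI1) (auto simp: drain_def max_def)
      then show ?thesis
        unfolding \<psi>_def by (subst ennreal_mult[symmetric]) (use k in \<open>auto intro!: ennreal_leI mult_left_mono\<close>)
    qed
    ultimately have "ennreal (exp (- rate * t)) * ?f (drain x t) + arrivals ?\<sigma> H t x \<le>
        ennreal (\<psi> t) + ennreal (\<psi> 0 - \<psi> t)"
      by (rule add_mono[rotated])
    also have "\<dots> = ennreal (\<psi> 0)"
    proof -
      have "\<psi> t \<le> 1 * (1 + exp (\<epsilon> * (x - t)))"
        unfolding \<psi>_def using t rate_pos by (intro mult_mono) auto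
      also have "\<dots> \<le> \<psi> 0"
        unfolding \<psi>_def using B0 \<epsilon> t by simp
      finally have "\<psi> t \<le> \<psi> 0" .
      then show ?thesis unfolding \<psi>_def by (subst ennreal_plus[symmetric]) auto
    qed
    also have "\<psi> 0 = 1 + exp (\<epsilon> * (x - t)) + B * (1 - exp (- \<epsilon> * t))"
      by (simp add: \<psi>_def)
    finally show "ennreal (exp (- rate * t)) * ?f (drain x t) + arrivals ?\<sigma> H t x \<le> H t x"
      unfolding H_def .
  qed (use t in auto)
  also have "H t x \<le> ennreal (1 + exp (\<epsilon> * (x - t)) + B)"
    unfolding H_def using B0 by (intro ennreal_leI) (simp add: algebra_simps)
  finally show ?thesis by (simp add: B_def)
qed

text \<open>The comparison principle requires a bounded function, hence the truncation. The
  truncated bound does not depend on the level, so monotone convergence removes it.\<close>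

lemma exponential_moment:
  assumes "0 < \<epsilon>" "integrable G (\<lambda>y. exp (\<epsilon> * y))" "0 \<le> t"
  shows "expect (\<lambda>v. ennreal (exp (\<epsilon> * v))) t x \<le>
    ennreal (1 + exp (\<epsilon> * (x - t)) + rate * (\<integral>y. exp (\<epsilon> * (1 + y)) \<partial>G) / \<epsilon>)"
proof -
  let ?f = "\<lambda>k v. ennreal (min (exp (\<epsilon> * v)) (real k))"
  have "ennreal (exp (\<epsilon> * v)) = (SUP k. ?f k v)" for v
  proof (rule antisym)
    obtain k where "exp (\<epsilon> * v) \<le> real k" using real_arch_simple by blast
    then show "ennreal (exp (\<epsilon> * v)) \<le> (SUP k. ?f k v)"
      by (intro SUP_upper2[of k]) auto
  qed (auto intro!: SUP_least ennreal_leI)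
  then have "expect (\<lambda>v. ennreal (exp (\<epsilon> * v))) t x = (SUP k. expect (?f k) t x)"
    unfolding expect_def
    by (subst nn_integral_monotone_convergence_SUP[symmetric])
      (auto intro!: ennreal_leI min.mono simp: incseq_def le_fun_def)
  also have "\<dots> \<le> ennreal (1 + exp (\<epsilon> * (x - t)) + rate * (\<integral>y. exp (\<epsilon> * (1 + y)) \<partial>G) / \<epsilon>)"
    using assms by (intro SUP_least exponential_moment_truncated) auto
  finally show ?thesis .
qed

section \<open>Coupling\<close>

text \<open>
  The dominating process with jumps \<open>w \<mapsto> max w (1 + y)\<close> is killed at \<open>0\<close>, where two coupled
  workloads meet.  The Lyapunov function \<open>B * (1 - exp (- (rate + 1) * w)) + exp (\<epsilon> * w)\<close> is steep near
  \<open>0\<close>, to compensate for the jumps out of a compact set, and exponential at infinity.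
\<close>
lemma coupling_rate:
  assumes \<epsilon>: "0 < \<epsilon>" and C: "0 \<le> C"
  obtains B \<alpha> where "0 \<le> B" "0 < \<alpha>"
    "\<And>w. 0 \<le> w \<Longrightarrow> rate * (B + exp (\<epsilon> * w) + C * exp (- \<epsilon> * w)) \<le>
      (rate - \<alpha>) * (B * (1 - exp (- (rate + 1) * w)) + exp (\<epsilon> * w)) +
      (B * (rate + 1) * exp (- (rate + 1) * w) + \<epsilon> * exp (\<epsilon> * w))"
proof -
  \<comment> \<open>Steepness \<open>rate + 1\<close> exceeds \<open>rate\<close> by one, so the
    bounded part of the Lyapunov function leaves a net gain
    \<open>B * exp (- (rate + 1) * w)\<close>. Up to \<open>w0\<close> this gain covers the jump
    term \<open>rate * C * exp (- \<epsilon> * w)\<close>, which fixes \<open>B\<close>; beyond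
    \<open>w0\<close> half of the slope \<open>\<epsilon> * exp (\<epsilon> * w)\<close> covers it.
    The choice of \<open>\<alpha>\<close> spends another quarter of that slope on the decay in
    time.\<close>
  define w0 where "w0 = 2 * rate * C / \<epsilon>\<^sup>2"
  define B where "B = rate * C * exp ((rate + 1) * w0)"
  define \<alpha> where "\<alpha> = \<epsilon> / 4 / (B + 1)"
  have B: "0 \<le> B" using C rate_pos by (simp add: B_def)
  have \<alpha>: "0 < \<alpha>" using B \<epsilon> by (simp add: \<alpha>_def)
  have \<alpha>_eq: "\<alpha> * B + \<alpha> = \<epsilon> / 4"
  proof -
    have "B + 1 \<noteq> 0" using B by simp
    then have "\<alpha> * (B + 1) = \<epsilon> / 4"
      using \<alpha>_def by (rule iffD1[OF nonzero_eq_divide_eq])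
    then show ?thesis by (simp add: distrib_left)
  qed
  have "rate * (B + exp (\<epsilon> * w) + C * exp (- \<epsilon> * w)) \<le>
      (rate - \<alpha>) * (B * (1 - exp (- (rate + 1) * w)) + exp (\<epsilon> * w)) +
      (B * (rate + 1) * exp (- (rate + 1) * w) + \<epsilon> * exp (\<epsilon> * w))" if w: "0 \<le> w" for w
  proof -
    define p q where "p = exp (\<epsilon> * w)" and "q = exp (- (rate + 1) * w)"
    have p: "1 \<le> p" and q: "0 < q" using w \<epsilon> by (auto simp: p_def q_def)
    have "rate * (C * exp (- \<epsilon> * w)) \<le> B * q + \<epsilon> / 2 * p"
    proof (cases "w \<le> w0")
      case True
      have "rate * C * exp (- \<epsilon> * w) \<le> rate * C * 1"
        using rate_pos C \<epsilon> w by (intro mult_left_mono) auto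
      also have "\<dots> \<le> rate * C * exp ((rate + 1) * (w0 - w))"
        using rate_pos C True by (intro mult_left_mono) auto
      also have "\<dots> = B * q"
        by (simp add: B_def q_def exp_add[symmetric] algebra_simps)
      finally show ?thesis using \<epsilon> p by (simp add: add_increasing2 mult.assoc)
    next
      case False
      have "\<epsilon> * (rate * C) \<le> \<epsilon> * (\<epsilon> / 2 * (\<epsilon> * w))"
        using False \<epsilon> by (simp add: w0_def field_simps power2_eq_square)
      then have "rate * C \<le> \<epsilon> / 2 * (\<epsilon> * w)"
        using \<epsilon> by (simp only: mult_le_cancel_left_pos)
      also have "\<dots> \<le> \<epsilon> / 2 * exp (\<epsilon> * w)"
      proof (rule mult_left_mono)
        show "\<epsilon> * w \<le> exp (\<epsilon> * w)" using exp_ge_add_one_self[of "\<epsilon> * w"] by linarith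
      qed (use \<epsilon> in simp)
      also have "\<dots> \<le> \<epsilon> / 2 * (p * p)"
        using \<epsilon> p by (intro mult_left_mono) (auto simp: p_def)
      finally have "rate * C * exp (- \<epsilon> * w) \<le> \<epsilon> / 2 * (p * p) * exp (- \<epsilon> * w)"
        by (intro mult_right_mono) auto
      also have "\<dots> = \<epsilon> / 2 * p"
        by (simp add: p_def exp_add[symmetric])
      finally show ?thesis using B q by (simp add: add_increasing mult.assoc)
    qed
    moreover have "\<alpha> * B \<le> \<alpha> * B * p" using \<alpha> B p mult_left_mono[of 1 p "\<alpha> * B"] by simp
    moreover have "\<alpha> * B * p + \<alpha> * p = \<epsilon> / 4 * p" unfolding \<alpha>_eq[symmetric] by (rule distrib_right[symmetric])
    moreover have "0 \<le> \<alpha> * B * q" "0 \<le> \<epsilon> * p" using \<alpha> B q \<epsilon> p by simp_all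
    ultimately show ?thesis
      unfolding p_def[symmetric] q_def[symmetric] by (simp add: algebra_simps)
  qed
  with B \<alpha> show thesis by (rule that)
qed

text \<open>For \<open>f\<close> with values in [0, 1], the expectations from \<open>x\<close> and
  \<open>y\<close> differ by at most the probability that workloads with common input still differ
  at time \<open>t\<close>. On unmerged pairs this probability is bounded by
  \<open>exp (- \<alpha> * t)\<close> times the Lyapunov function of the maximum, which is at least
  1 there; the inequality from \<open>coupling_rate\<close> says that it decays at rate \<alpha> in
  the mean.\<close>

lemma expect_coupling:
  assumes \<epsilon>: "0 < \<epsilon>" and int: "integrable G (\<lambda>y. exp (2 * \<epsilon> * y))"
  obtains B \<alpha> where "0 \<le> B" "0 < \<alpha>"
    "\<And>f t x y. f \<in> borel_measurable borel \<Longrightarrow> (\<And>v. f v \<le> 1) \<Longrightarrow> 0 \<le> t \<Longrightarrow>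
      expect f t x \<le> expect f t y + ennreal (exp (- \<alpha> * t) * (B + exp (\<epsilon> * x) + exp (\<epsilon> * y)))"
proof -
  have int': "integrable G (\<lambda>y. exp (2 * \<epsilon> * (1 + y)))"
    using int by (simp add: distrib_left exp_add)
  define C where "C = (\<integral>y. exp (2 * \<epsilon> * (1 + y)) \<partial>G)"
  have C: "0 \<le> C" by (simp add: C_def)
  obtain B \<alpha> where B: "0 \<le> B" and \<alpha>: "0 < \<alpha>"
    and ineq: "\<And>w. 0 \<le> w \<Longrightarrow> rate * (B + exp (\<epsilon> * w) + C * exp (- \<epsilon> * w)) \<le>
      (rate - \<alpha>) * (B * (1 - exp (- (rate + 1) * w)) + exp (\<epsilon> * w)) +
      (B * (rate + 1) * exp (- (rate + 1) * w) + \<epsilon> * exp (\<epsilon> * w))"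
    using coupling_rate[OF \<epsilon> C] by blast
  define \<Phi> where "\<Phi> w = B * (1 - exp (- (rate + 1) * w)) + exp (\<epsilon> * w)" for w
  define \<Phi>' where "\<Phi>' w = B * (rate + 1) * exp (- (rate + 1) * w) + \<epsilon> * exp (\<epsilon> * w)" for w
  have \<Phi>_le: "\<Phi> w \<le> B + exp (\<epsilon> * w)" for w
    using B by (simp add: \<Phi>_def algebra_simps)
  have \<Phi>_ge: "1 \<le> \<Phi> w" if "0 \<le> w" for w
  proof -
    have "0 \<le> (rate + 1) * w" "0 \<le> \<epsilon> * w" using that rate_pos \<epsilon> by auto
    then have "exp (- (rate + 1) * w) \<le> 1" "1 \<le> exp (\<epsilon> * w)" by (auto simp: algebra_simps)
    then show ?thesis unfolding \<Phi>_def using B by (intro add_increasing mult_nonneg_nonneg) auto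
  qed
  \<comment> \<open>The bound vanishes on merged pairs. Pairs of nonpositive states count as merged,
    since both drain to 0 at once.\<close>
  define H where "H t z = (if fst z = snd z \<or> max (fst z) (snd z) \<le> 0 then 0
      else ennreal (exp (- \<alpha> * t) * \<Phi> (max (fst z) (snd z))))" for t and z :: "real \<times> real"
  let ?s = "\<lambda>u s x. jump (drain x u) s"
  let ?\<sigma> = "\<lambda>u s z. (?s u s (fst z), ?s u s (snd z))"
  have H_meas [measurable]: "(\<lambda>z. H (p z) (q z, q' z)) \<in> borel_measurable N"
    if [measurable]: "p \<in> borel_measurable N" "q \<in> borel_measurable N" "q' \<in> borel_measurable N"
    for p q q' and N :: "'c measure"
    unfolding H_def \<Phi>_def by simp measurable
  have H_super: "ennreal (exp (- rate * t)) * of_bool (drain (fst z) t \<noteq> drain (snd z) t) + arrivals ?\<sigma> H t z \<le> H t z"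
    if t: "0 \<le> t" for t z
  proof (cases "fst z = snd z \<or> max (fst z) (snd z) \<le> 0")
    case True
    \<comment> \<open>A merged pair stays merged: it drains to a common state and then receives the
      same service, so every term on the left vanishes.\<close>
    then have same: "drain (fst z) u = drain (snd z) u" if "0 \<le> u" for u
      using that by (auto simp: drain_def)
    have "arrivals ?\<sigma> H t z \<le> ennreal ((\<lambda>_. 0) 0 - (\<lambda>_. 0) t)"
      unfolding arrivals_def
    proof (rule nn_integral_gap_le[where \<psi>' = "\<lambda>_. 0"])
      show "(\<lambda>u. \<integral>\<^sup>+y. H (t - u) (?\<sigma> u y z) \<partial>G) \<in> borel_measurable borel" by measurable
    qed (use t same in \<open>auto simp: H_def\<close>)
    with same[OF t] show ?thesis by simp
  next
    case False
    define m where "m = max (fst z) (snd z)"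
    \<comment> \<open>With no arrival before time \<open>m\<close> both workloads are empty, hence
      merged. Only arrivals up to \<open>min t m\<close> contribute.\<close>
    define a where "a = min t m"
    have m: "0 < m" and a: "0 \<le> a" "a \<le> t" "a \<le> m" using False t by (auto simp: m_def a_def)
    \<comment> \<open>The exponent is \<open>- rate * u - \<alpha> * (t - u)\<close>: again the
      supersolution along the draining path, discounted by the probability of no arrival.\<close>
    define \<psi> where "\<psi> u = exp ((\<alpha> - rate) * u - \<alpha> * t) * \<Phi> (m - u)" for u
    define \<psi>' where "\<psi>' u = exp ((\<alpha> - rate) * u - \<alpha> * t) * ((rate - \<alpha>) * \<Phi> (m - u) + \<Phi>' (m - u))" for u
    define h where "h u = (\<integral>\<^sup>+y. H (t - u) (?\<sigma> u y z) \<partial>G)" for u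
    have h_meas [measurable]: "h \<in> borel_measurable borel" unfolding h_def by measurable
    have deriv: "(\<psi> has_real_derivative - \<psi>' u) (at u)" for u
      unfolding \<psi>_def \<psi>'_def \<Phi>_def \<Phi>'_def
      by (auto intro!: derivative_eq_intros simp: algebra_simps)
    have ineq': "rate * exp (- rate * u) * (exp (- \<alpha> * (t - u)) * (B + exp (\<epsilon> * (m - u)) + C * exp (- \<epsilon> * (m - u)))) \<le> \<psi>' u"
      if "u \<le> a" for u
    proof -
      have "exp ((\<alpha> - rate) * u - \<alpha> * t) = exp (- rate * u) * exp (- \<alpha> * (t - u))"
        by (simp add: exp_add[symmetric] algebra_simps)
      moreover have "exp ((\<alpha> - rate) * u - \<alpha> * t) * (rate * (B + exp (\<epsilon> * (m - u)) + C * exp (- \<epsilon> * (m - u)))) \<le> \<psi>' u"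
        unfolding \<psi>'_def \<Phi>_def \<Phi>'_def using that a by (intro mult_left_mono ineq) auto
      ultimately show ?thesis by (simp add: mult_ac)
    qed
    have nonneg: "0 \<le> \<psi>' u" if "u \<le> a" for u
      by (rule order_trans[OF _ ineq'[OF that]]) (use rate_pos B C in auto)
    have h_le: "h u \<le> ennreal (exp (- \<alpha> * (t - u)) * (B + exp (\<epsilon> * (m - u)) + C * exp (- \<epsilon> * (m - u))))" if "u \<le> a" for u
      unfolding h_def
    proof (rule nn_integral_G_le[where h = "\<lambda>y. exp (- \<alpha> * (t - u)) *
          (B + exp (\<epsilon> * (m - u)) + exp (2 * \<epsilon> * (1 + y)) * exp (- \<epsilon> * (m - u)))"])
      fix y
      let ?M = "max (?s u y (fst z)) (?s u y (snd z))"
      have "?M \<le> max (m - u) (1 + y)"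
        using jump_drain_le[of "fst z" u y] jump_drain_le[of "snd z" u y] by (auto simp: m_def)
      then have "exp (\<epsilon> * ?M) \<le> exp (\<epsilon> * max (m - u) (1 + y))" using \<epsilon> by simp
      \<comment> \<open>When \<open>1 + y\<close> is the larger level, half of the exponent
        \<open>2 * \<epsilon> * (1 + y)\<close> is traded for the factor
        \<open>exp (- \<epsilon> * (m - u))\<close>. This is where the moment of order
        \<open>2 * \<epsilon>\<close> produces the decaying jump term of
        \<open>coupling_rate\<close>.\<close>
      also have "\<dots> \<le> exp (\<epsilon> * (m - u)) + exp (2 * \<epsilon> * (1 + y)) * exp (- \<epsilon> * (m - u))"
      proof (cases "m - u \<le> 1 + y")
        case True
        then have "\<epsilon> * (m - u) \<le> \<epsilon> * (1 + y)" using \<epsilon> by simp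
        then have "exp (\<epsilon> * (1 + y)) \<le> exp (2 * \<epsilon> * (1 + y)) * exp (- \<epsilon> * (m - u))"
          unfolding exp_add[symmetric] by simp
        with True show ?thesis by (simp add: max_def add_increasing)
      qed (simp add: max_def)
      finally have "\<Phi> ?M \<le> B + exp (\<epsilon> * (m - u)) + exp (2 * \<epsilon> * (1 + y)) * exp (- \<epsilon> * (m - u))"
        using \<Phi>_le[of ?M] by simp
      then show "H (t - u) (?\<sigma> u y z) \<le> ennreal (exp (- \<alpha> * (t - u)) *
          (B + exp (\<epsilon> * (m - u)) + exp (2 * \<epsilon> * (1 + y)) * exp (- \<epsilon> * (m - u))))"
        unfolding H_def by (auto intro!: ennreal_leI mult_left_mono)
    qed (use int' B in \<open>auto simp: C_def G.prob_space[unfolded space_G]\<close>)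
    have h_zero: "h u = 0" if "m \<le> u" for u
    proof -
      have "drain (fst z) u = 0" "drain (snd z) u = 0" using that by (auto simp: m_def drain_def)
      then show ?thesis by (simp add: h_def H_def)
    qed
    have "arrivals ?\<sigma> H t z = (\<integral>\<^sup>+u. h u * indicator {..a} u \<partial>gap)"
      unfolding arrivals_def h_def[symmetric]
      by (intro nn_integral_cong) (use a h_zero in \<open>auto simp: a_def min_def split: split_indicator if_splits\<close>)
    also have "\<dots> \<le> ennreal (\<psi> 0 - \<psi> a)"
    proof (rule nn_integral_gap_le[OF h_meas _ a(1) deriv nonneg])
      show "\<psi>' \<in> borel_measurable borel" unfolding \<psi>'_def \<Phi>_def \<Phi>'_def by measurable
      fix u assume "u \<le> a"
      have "ennreal (rate * exp (- rate * u)) * h u \<le> ennreal (rate * exp (- rate * u)) *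
          ennreal (exp (- \<alpha> * (t - u)) * (B + exp (\<epsilon> * (m - u)) + C * exp (- \<epsilon> * (m - u))))"
        using h_le[OF \<open>u \<le> a\<close>] by (intro mult_left_mono) auto
      also have "\<dots> \<le> ennreal (\<psi>' u)"
        using ineq'[OF \<open>u \<le> a\<close>] rate_pos by (subst ennreal_mult'[symmetric]) (auto intro!: ennreal_leI)
      finally show "ennreal (rate * exp (- rate * u)) * h u \<le> ennreal (\<psi>' u)" .
    qed
    finally have arr: "arrivals ?\<sigma> H t z \<le> ennreal (\<psi> 0 - \<psi> a)" .
    \<comment> \<open>\<open>ennreal\<close> cuts negative numbers off at 0, so this order is what
      lets \<open>\<psi> a\<close> and \<open>\<psi> 0 - \<psi> a\<close> add up to
      \<open>\<psi> 0\<close>.\<close>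
    have "\<psi> a \<le> \<psi> 0"
      using a deriv nonneg by (intro DERIV_nonpos_imp_nonincreasing[of 0 a \<psi>]) fastforce+
    have "ennreal (exp (- rate * t)) * of_bool (drain (fst z) t \<noteq> drain (snd z) t) \<le> ennreal (\<psi> a)"
    proof (cases "t < m")
      case True
      have "exp (- rate * t) * 1 \<le> exp (- rate * t) * \<Phi> (m - t)"
        using True by (intro mult_left_mono \<Phi>_ge) auto
      also have "\<dots> = \<psi> a"
        using True by (simp add: \<psi>_def a_def algebra_simps)
      finally show ?thesis by (simp add: ennreal_leI)
    next
      case False
      then have "drain (fst z) t = 0" "drain (snd z) t = 0" by (auto simp: m_def drain_def)
      then show ?thesis by simp
    qed
    with arr have "ennreal (exp (- rate * t)) * of_bool (drain (fst z) t \<noteq> drain (snd z) t) + arrivals ?\<sigma> H t z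
        \<le> ennreal (\<psi> a) + ennreal (\<psi> 0 - \<psi> a)"
      by (intro add_mono)
    also have "\<dots> = ennreal (\<psi> 0)"
      using \<open>\<psi> a \<le> \<psi> 0\<close> \<Phi>_ge[of "m - a"] a by (subst ennreal_plus[symmetric]) (auto simp: \<psi>_def)
    also have "\<dots> = H t z" using False by (auto simp: H_def \<psi>_def m_def)
    finally show ?thesis .
  qed
  show thesis
  proof (rule that[OF B \<alpha>])
    fix f :: "real \<Rightarrow> ennreal" and t x y :: real
    assume f [measurable]: "f \<in> borel_measurable borel" and f_le: "\<And>v. f v \<le> 1" and t: "0 \<le> t"
    let ?F = "\<lambda>t z. expect f t (fst z)" and ?H = "\<lambda>t z. expect f t (snd z) + H t z"
    have "?F t (x, y) \<le> ?H t (x, y)"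
    proof (rule comparison[where F = ?F and H = ?H and c = 1 and \<sigma> = ?\<sigma>
          and b = "\<lambda>t z. ennreal (exp (- rate * t)) * f (drain (fst z) t)"])
      fix t :: real and z :: "real \<times> real" assume t: "0 \<le> t"
      show "?F t z \<le> ennreal 1" using expect_le[of f 1] f_le by simp
      show "?F t z \<le> ennreal (exp (- rate * t)) * f (drain (fst z) t) + arrivals ?\<sigma> ?F t z"
        using expect_renewal[OF f t, of "fst z"] by (simp add: arrivals_def)
      have "arrivals ?\<sigma> ?H t z = (\<integral>\<^sup>+u. (\<integral>\<^sup>+y. expect f (t - u) (?s u y (snd z)) \<partial>G) * indicator {..t} u +
          (\<integral>\<^sup>+y. H (t - u) (?\<sigma> u y z) \<partial>G) * indicator {..t} u \<partial>gap)"
        unfolding arrivals_def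
        by (intro nn_integral_cong, simp only: snd_conv, subst nn_integral_add) (auto simp: distrib_right)
      also have "\<dots> = arrivals ?s (expect f) t (snd z) + arrivals ?\<sigma> H t z"
        unfolding arrivals_def by (rule nn_integral_add) measurable
      finally have arr: "arrivals ?\<sigma> ?H t z = arrivals ?s (expect f) t (snd z) + arrivals ?\<sigma> H t z" .
      have "ennreal (exp (- rate * t)) * f (drain (fst z) t) \<le>
        ennreal (exp (- rate * t)) * f (drain (snd z) t) +
        ennreal (exp (- rate * t)) * of_bool (drain (fst z) t \<noteq> drain (snd z) t)"
        using mult_left_mono[OF f_le[of "drain (fst z) t"], of "ennreal (exp (- rate * t))"]
        by (cases "drain (fst z) t = drain (snd z) t") (simp_all add: add_increasing)
      then have "ennreal (exp (- rate * t)) * f (drain (fst z) t) + arrivals ?\<sigma> ?H t z \<le>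
        (ennreal (exp (- rate * t)) * f (drain (snd z) t) +
        ennreal (exp (- rate * t)) * of_bool (drain (fst z) t \<noteq> drain (snd z) t)) +
        (arrivals ?s (expect f) t (snd z) + arrivals ?\<sigma> H t z)"
        unfolding arr by (rule add_right_mono)
      also have "\<dots> = expect f t (snd z) +
        (ennreal (exp (- rate * t)) * of_bool (drain (fst z) t \<noteq> drain (snd z) t) + arrivals ?\<sigma> H t z)"
        by (subst expect_renewal[OF f t, of "snd z"]) (simp add: add_ac)
      also have "\<dots> \<le> ?H t z" by (intro add_left_mono H_super t)
      finally show "ennreal (exp (- rate * t)) * f (drain (fst z) t) + arrivals ?\<sigma> ?H t z \<le> ?H t z" .
    next
      fix t :: real and z :: "real \<times> real"
      show "(\<lambda>(u, y). ?H (t - u) (?\<sigma> u y z)) \<in> borel_measurable (gap \<Otimes>\<^sub>M G)"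
        by (simp add: split_beta')
    qed (rule t)
    also have "H t (x, y) \<le> ennreal (exp (- \<alpha> * t) * (B + exp (\<epsilon> * x) + exp (\<epsilon> * y)))"
    proof -
      have "\<Phi> (max x y) \<le> B + exp (\<epsilon> * x) + exp (\<epsilon> * y)"
        using \<Phi>_le[of x] \<Phi>_le[of y] exp_gt_zero[of "\<epsilon> * x"] exp_gt_zero[of "\<epsilon> * y"] by (simp add: max_def del: exp_gt_zero)
      then show ?thesis unfolding H_def by (auto intro!: ennreal_leI mult_left_mono)
    qed
    finally show "expect f t x \<le> expect f t y + ennreal (exp (- \<alpha> * t) * (B + exp (\<epsilon> * x) + exp (\<epsilon> * y)))"
      by (simp add: add_left_mono)
  qed
qed

end

section \<open>Convergence in total variation\<close>

lemma nn_integral_layer_cake: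
  fixes h :: "'a \<Rightarrow> ennreal"
  assumes "sigma_finite_measure M" and h [measurable]: "h \<in> borel_measurable M" and h_le: "\<And>x. h x \<le> 1"
  shows "(\<integral>\<^sup>+x. h x \<partial>M) = (\<integral>\<^sup>+s. emeasure M {x \<in> space M. ennreal s < h x} * indicator {0..<1} s \<partial>lborel)"
proof -
  interpret sigma_finite_measure M by fact
  interpret pair_sigma_finite lborel M ..
  have h_eq: "h x = (\<integral>\<^sup>+s. indicator {s. ennreal s < h x} s * indicator {0..<1} s \<partial>lborel)" for x
  proof -
    obtain r where r: "0 \<le> r" "h x = ennreal r"
      using h_le[of x] by (cases "h x") (auto simp: top_unique)
    then have "r \<le> 1" using h_le[of x] by simp
    have "(\<integral>\<^sup>+s. indicator {s. ennreal s < h x} s * indicator {0..<1} s \<partial>lborel) = (\<integral>\<^sup>+s. indicator {0..<r} s \<partial>lborel)"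
      using r \<open>r \<le> 1\<close> by (intro nn_integral_cong) (auto simp: ennreal_less_iff split: split_indicator)
    then show ?thesis using r by simp
  qed
  have "(\<integral>\<^sup>+x. h x \<partial>M) = (\<integral>\<^sup>+x. \<integral>\<^sup>+s. indicator {s. ennreal s < h x} s * indicator {0..<1} s \<partial>lborel \<partial>M)"
    by (subst h_eq) (rule refl)
  also have "\<dots> = (\<integral>\<^sup>+s. \<integral>\<^sup>+x. indicator {s. ennreal s < h x} s * indicator {0..<1} s \<partial>M \<partial>lborel)"
    by (rule Fubini') measurable
  also have "\<dots> = (\<integral>\<^sup>+s. emeasure M {x \<in> space M. ennreal s < h x} * indicator {0..<1} s \<partial>lborel)"
  proof (intro nn_integral_cong)
    fix s :: real
    have "(\<integral>\<^sup>+x. indicator {s. ennreal s < h x} s * indicator {0..<1} s \<partial>M) =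
        (\<integral>\<^sup>+x. indicator {x \<in> space M. ennreal s < h x} x * indicator {0..<1} s \<partial>M)"
      by (intro nn_integral_cong) (auto split: split_indicator)
    also have "\<dots> = emeasure M {x \<in> space M. ennreal s < h x} * indicator {0..<1} s"
      by (subst nn_integral_multc) auto
    finally show "(\<integral>\<^sup>+x. indicator {s. ennreal s < h x} s * indicator {0..<1} s \<partial>M) =
        emeasure M {x \<in> space M. ennreal s < h x} * indicator {0..<1} s" .
  qed
  finally show ?thesis .
qed

text \<open>Each level set of \<open>h\<close> contributes an error of at most \<open>d\<close>, and
  the levels range over an interval of length one, so nothing is lost in passing from sets to
  functions.\<close>

lemma nn_integral_le_of_emeasure_le:
  assumes \<mu>: "sigma_finite_measure \<mu>" and \<nu>: "sigma_finite_measure \<nu>" and sets: "sets \<mu> = sets \<nu>"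
    and le: "\<And>A. A \<in> sets \<nu> \<Longrightarrow> emeasure \<mu> A \<le> emeasure \<nu> A + d"
    and h: "h \<in> borel_measurable \<nu>" and h_le: "\<And>x. h x \<le> 1"
  shows "(\<integral>\<^sup>+x. h x \<partial>\<mu>) \<le> (\<integral>\<^sup>+x. h x \<partial>\<nu>) + d"
proof -
  interpret \<nu>: sigma_finite_measure \<nu> by fact
  have h' [measurable]: "h \<in> borel_measurable \<mu>" using h by (simp add: measurable_cong_sets[OF sets refl])
  note h [measurable]
  have space: "space \<mu> = space \<nu>" using sets by (rule sets_eq_imp_space_eq)
  have [measurable]: "(\<lambda>s. emeasure \<nu> {x \<in> space \<nu>. ennreal s < h x}) \<in> borel_measurable lborel"
    by measurable
  have "(\<integral>\<^sup>+x. h x \<partial>\<mu>) = (\<integral>\<^sup>+s. emeasure \<mu> {x \<in> space \<nu>. ennreal s < h x} * indicator {0..<1} s \<partial>lborel)"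
    using nn_integral_layer_cake[OF \<mu> h' h_le] by (simp add: space)
  also have "\<dots> \<le> (\<integral>\<^sup>+s. emeasure \<nu> {x \<in> space \<nu>. ennreal s < h x} * indicator {0..<1} s + d * indicator {0..<1} s \<partial>lborel)"
    by (intro nn_integral_mono) (auto intro!: le split: split_indicator)
  also have "\<dots> = (\<integral>\<^sup>+x. h x \<partial>\<nu>) + d"
    unfolding nn_integral_layer_cake[OF \<nu> h h_le]
    by (subst nn_integral_add) (auto simp: nn_integral_cmult)
  finally show ?thesis .
qed

text \<open>Finite additivity passes to the setwise limit. Countable additivity needs that \<delta>
  does not depend on the set: it yields continuity of the limit at the empty set.\<close>

lemma uniform_limit_measure:
  fixes p :: "nat \<Rightarrow> 'a measure"
  assumes prob: "\<And>n. prob_space (p n)" and sets: "\<And>n. sets (p n) = sets N"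
    and cauchy: "\<And>n m A. n \<le> m \<Longrightarrow> A \<in> sets N \<Longrightarrow> \<bar>measure (p n) A - measure (p m) A\<bar> \<le> \<delta> n"
    and \<delta>: "\<delta> \<longlonglongrightarrow> 0"
  obtains \<pi> where "prob_space \<pi>" "sets \<pi> = sets N"
    "\<And>A. A \<in> sets N \<Longrightarrow> (\<lambda>n. measure (p n) A) \<longlonglongrightarrow> measure \<pi> A"
proof -
  interpret p: prob_space "p n" for n by (rule prob)
  have space: "space (p n) = space N" for n using sets by (rule sets_eq_imp_space_eq)
  define q where "q A = lim (\<lambda>n. measure (p n) A)" for A
  have q_lim: "(\<lambda>n. measure (p n) A) \<longlonglongrightarrow> q A" if A: "A \<in> sets N" for A
  proof -
    have "Cauchy (\<lambda>n. measure (p n) A)"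
    proof (rule metric_CauchyI)
      fix e :: real assume "0 < e"
      then obtain k where k: "\<And>n. k \<le> n \<Longrightarrow> \<bar>\<delta> n\<bar> < e"
        using LIMSEQ_D[OF \<delta>, of e] by auto
      have "\<bar>measure (p m) A - measure (p n) A\<bar> < e" if "k \<le> m" "k \<le> n" for m n
        using cauchy[of m n, OF _ A] cauchy[of n m, OF _ A] k[OF that(1)] k[OF that(2)] by (cases "m \<le> n") auto
      then show "\<exists>M. \<forall>m\<ge>M. \<forall>n\<ge>M. dist (measure (p m) A) (measure (p n) A) < e"
        by (auto simp: dist_real_def)
    qed
    then show ?thesis unfolding q_def using Cauchy_convergent convergent_LIMSEQ_iff by blast
  qed
  have q_nonneg: "0 \<le> q A" if "A \<in> sets N" for A
    by (rule LIMSEQ_le_const[OF q_lim[OF that]]) auto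
  have q_le: "q A \<le> measure (p n) A + \<delta> n" if A: "A \<in> sets N" for A n
  proof (rule LIMSEQ_le_const2[OF q_lim[OF A]])
    show "\<exists>k. \<forall>m\<ge>k. measure (p m) A \<le> measure (p n) A + \<delta> n"
      using cauchy[OF _ A] by (intro exI[of _ n]) (auto simp: abs_le_iff algebra_simps)
  qed
  have q_space: "q (space N) = 1"
    using q_lim[OF sets.top] p.prob_space unfolding space by (simp add: LIMSEQ_const_iff)
  have q_empty: "q {} = 0"
    using q_lim[of "{}"] by (simp add: LIMSEQ_const_iff)
  have q_add: "q (A \<union> B) = q A + q B" if "A \<in> sets N" "B \<in> sets N" "A \<inter> B = {}" for A B
  proof (rule LIMSEQ_unique)
    show "(\<lambda>n. measure (p n) (A \<union> B)) \<longlonglongrightarrow> q (A \<union> B)" using that by (intro q_lim) auto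
    have "measure (p n) (A \<union> B) = measure (p n) A + measure (p n) B" for n
      using that sets by (intro p.finite_measure_Union) auto
    then show "(\<lambda>n. measure (p n) (A \<union> B)) \<longlonglongrightarrow> q A + q B"
      using that by (simp add: tendsto_add q_lim)
  qed
  have q_cont: "(\<lambda>i. q (A i)) \<longlonglongrightarrow> 0"
    if A: "range A \<subseteq> sets N" "decseq A" "(\<Inter>i. A i) = {}" for A
  proof (rule LIMSEQ_I)
    fix e :: real assume e: "0 < e"
    \<comment> \<open>The index \<open>n\<close> is fixed before the sets shrink; continuity of the
      single measure \<open>p n\<close> then finishes, the remaining error \<open>\<delta> n\<close>
      being uniform in the set.\<close>
    then obtain n where n: "\<bar>\<delta> n\<bar> < e / 2"
      using LIMSEQ_D[OF \<delta>, of "e / 2"] by auto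
    have "(\<lambda>i. measure (p n) (A i)) \<longlonglongrightarrow> measure (p n) (\<Inter>i. A i)"
      using A sets by (intro p.finite_Lim_measure_decseq) auto
    then have "(\<lambda>i. measure (p n) (A i)) \<longlonglongrightarrow> 0" by (simp add: A(3))
    then have "\<forall>\<^sub>F i in sequentially. measure (p n) (A i) < e / 2"
      using e by (intro order_tendstoD(2)) auto
    then obtain k where k: "\<And>i. k \<le> i \<Longrightarrow> measure (p n) (A i) < e / 2"
      by (auto simp: eventually_sequentially)
    have "norm (q (A i) - 0) < e" if "k \<le> i" for i
      using q_nonneg[of "A i"] q_le[of "A i" n] k[OF that] n A(1) by auto
    then show "\<exists>k. \<forall>i\<ge>k. norm (q (A i) - 0) < e" by blast
  qed
  define \<pi> where "\<pi> = measure_of (space N) (sets N) (\<lambda>A. ennreal (q A))"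
  have sets_\<pi>: "sets \<pi> = sets N" and space_\<pi>: "space \<pi> = space N"
    by (auto simp: \<pi>_def sets.space_closed)
  have em: "emeasure \<pi> A = ennreal (q A)" if A: "A \<in> sets N" for A
  proof (rule emeasure_measure_of[OF \<pi>_def])
    show "positive (sets \<pi>) (\<lambda>A. ennreal (q A))" by (simp add: positive_def q_empty)
    have "countably_additive (sets N) (\<lambda>A. ennreal (q A))"
    proof (rule sets.empty_continuous_imp_countably_additive)
      show "positive (sets N) (\<lambda>A. ennreal (q A))" by (simp add: positive_def q_empty)
      show "additive (sets N) (\<lambda>A. ennreal (q A))"
        using q_nonneg by (auto simp: additive_def q_add)
      fix A assume A: "range A \<subseteq> sets N" "decseq A" "(\<Inter>i. A i) = {}"
      show "(\<lambda>i. ennreal (q (A i))) \<longlonglongrightarrow> 0"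
        using tendsto_ennrealI[OF q_cont[OF A]] by simp
    qed simp
    then show "countably_additive (sets \<pi>) (\<lambda>A. ennreal (q A))" by (simp add: sets_\<pi>)
  qed (use A sets.space_closed in \<open>auto simp: sets_\<pi>\<close>)
  have "measure \<pi> A = q A" if "A \<in> sets N" for A
    using em[OF that] q_nonneg[OF that] by (simp add: measure_def)
  moreover have "prob_space \<pi>"
    by (rule prob_spaceI) (simp add: space_\<pi> em q_space)
  ultimately show thesis using sets_\<pi> q_lim by (intro that[of \<pi>]) auto
qed

section \<open>Laws of the workload and their stationary limit\<close>

context canonical_input begin

definition law :: "real \<Rightarrow> real \<Rightarrow> real measure" where
  "law x t = distr input borel (\<lambda>w. workload_path (fst w) (snd w) x t)"

lemma sets_law [measurable_cong, simp]: "sets (law x t) = sets borel"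
  by (simp add: law_def)

lemma space_law [simp]: "space (law x t) = UNIV"
  by (simp add: law_def)

lemma prob_space_law: "prob_space (law x t)"
  unfolding law_def by (rule input.prob_space_distr) measurable

lemma nn_integral_law:
  assumes [measurable]: "h \<in> borel_measurable borel"
  shows "(\<integral>\<^sup>+v. h v \<partial>law x t) = expect h t x"
  unfolding law_def expect_def by (rule nn_integral_distr) measurable

lemma emeasure_law: "A \<in> sets borel \<Longrightarrow> emeasure (law x t) A = expect (indicator A) t x"
  using nn_integral_law[of "indicator A" x t] by simp

lemma emeasure_law_nonneg: "emeasure (law x t) {0..} = 1"
  by (simp add: emeasure_law expect_def workload_path_nonneg input.emeasure_space_1)

text \<open>By Chapman-Kolmogorov, the law at \<open>t'\<close> from 0 is the law at
  \<open>t\<close> from a random start, the workload at \<open>t' - t\<close>. Averaging the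
  coupling error over that start costs an exponential moment that is bounded uniformly in
  \<open>t' - t\<close>, so \<open>D x\<close> does not depend on \<open>t'\<close>.\<close>

lemma law_cauchy:
  assumes \<epsilon>: "0 < \<epsilon>" and int: "integrable G (\<lambda>y. exp (2 * \<epsilon> * y))"
  obtains \<alpha> D where "0 < \<alpha>" "\<And>x. 0 \<le> D x"
    "\<And>x t t' A. 0 \<le> t \<Longrightarrow> t \<le> t' \<Longrightarrow> A \<in> sets borel \<Longrightarrow>
      \<bar>measure (law x t) A - measure (law 0 t') A\<bar> \<le> D x * exp (- \<alpha> * t)"
proof -
  obtain B \<alpha> where B: "0 \<le> B" and \<alpha>: "0 < \<alpha>" and coupling:
    "\<And>f t x y. f \<in> borel_measurable borel \<Longrightarrow> (\<And>v. f v \<le> 1) \<Longrightarrow> 0 \<le> t \<Longrightarrow>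
      expect f t x \<le> expect f t y + ennreal (exp (- \<alpha> * t) * (B + exp (\<epsilon> * x) + exp (\<epsilon> * y)))"
    using expect_coupling[OF \<epsilon> int] by blast
  have int1: "integrable G (\<lambda>y. exp (\<epsilon> * y))"
  proof (rule Bochner_Integration.integrable_bound)
    show "integrable G (\<lambda>y. 1 + exp (2 * \<epsilon> * y))" using int by simp
    have "exp (\<epsilon> * y) \<le> 1 + exp (2 * \<epsilon> * y)" for y
    proof (cases "0 \<le> y")
      case True
      then have "\<epsilon> * y \<le> 2 * \<epsilon> * y" using \<epsilon> by simp
      then show ?thesis by (simp add: add_increasing)
    next
      case False
      then have "exp (\<epsilon> * y) \<le> 1" using \<epsilon> by (simp add: mult_le_0_iff)
      then show ?thesis by (simp add: add_increasing2)
    qed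
    then show "AE y in G. norm (exp (\<epsilon> * y)) \<le> norm (1 + exp (2 * \<epsilon> * y))"
      by (auto simp: abs_of_nonneg add_nonneg_nonneg)
  qed measurable
  \<comment> \<open>The 2 is the 1 of the moment bound plus
    \<open>exp (\<epsilon> * (0 - s))\<close>, which is at most 1.\<close>
  define m where "m = 2 + rate * (\<integral>y. exp (\<epsilon> * (1 + y)) \<partial>G) / \<epsilon>"
  have m: "0 \<le> m" using rate_pos \<epsilon> by (simp add: m_def)
  define D where "D x = B + exp (\<epsilon> * x) + m" for x
  have D: "0 \<le> D x" for x using B m by (simp add: D_def)
  have moment: "expect (\<lambda>v. ennreal (exp (- \<alpha> * t) * (B + exp (\<epsilon> * x) + exp (\<epsilon> * v)))) s 0 \<le>
      ennreal (D x * exp (- \<alpha> * t))" if s: "0 \<le> s" for s t x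
  proof -
    have "expect (\<lambda>v. ennreal (exp (- \<alpha> * t) * (B + exp (\<epsilon> * x) + exp (\<epsilon> * v)))) s 0 =
        expect (\<lambda>v. ennreal (exp (- \<alpha> * t)) * (ennreal (B + exp (\<epsilon> * x)) + ennreal (exp (\<epsilon> * v)))) s 0"
      using B by (simp add: ennreal_mult ennreal_plus add_nonneg_nonneg)
    also have "\<dots> = ennreal (exp (- \<alpha> * t)) * (ennreal (B + exp (\<epsilon> * x)) + expect (\<lambda>v. ennreal (exp (\<epsilon> * v))) s 0)"
      unfolding expect_def
      by (simp add: nn_integral_cmult nn_integral_add input.emeasure_space_1)
    also have "expect (\<lambda>v. ennreal (exp (\<epsilon> * v))) s 0 \<le> ennreal m"
    proof -
      have "exp (\<epsilon> * (0 - s)) \<le> 1" using \<epsilon> s by simp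
      then show ?thesis
        unfolding m_def
        by (intro order_trans[OF exponential_moment[OF \<epsilon> int1 s]] ennreal_leI) simp
    qed
    also have "ennreal (exp (- \<alpha> * t)) * (ennreal (B + exp (\<epsilon> * x)) + ennreal m) = ennreal (D x * exp (- \<alpha> * t))"
    proof -
      have "ennreal (B + exp (\<epsilon> * x)) + ennreal m = ennreal (D x)"
        unfolding D_def using B m by (intro ennreal_plus[symmetric]) auto
      then show ?thesis using D[of x] by (simp add: ennreal_mult mult.commute)
    qed
    finally show ?thesis by (simp add: add_left_mono mult_left_mono)
  qed
  have "\<bar>measure (law x t) A - measure (law 0 t') A\<bar> \<le> D x * exp (- \<alpha> * t)"
    if t: "0 \<le> t" "t \<le> t'" and A: "A \<in> sets borel" for x t t' A
  proof -
    let ?f = "indicator A :: real \<Rightarrow> ennreal"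
    let ?e = "\<lambda>v. ennreal (exp (- \<alpha> * t) * (B + exp (\<epsilon> * x) + exp (\<epsilon> * v)))"
    have f [measurable]: "?f \<in> borel_measurable borel" and f_le: "?f v \<le> 1" for v
      using A by (auto split: split_indicator)
    interpret l: prob_space "law x t" by (rule prob_space_law)
    interpret l': prob_space "law 0 t'" by (rule prob_space_law)
    have s: "0 \<le> t' - t" using t by simp
    have later: "emeasure (law 0 t') A = expect (expect ?f t) (t' - t) 0"
      using chapman_kolmogorov[OF f f_le s t(1), of 0] by (simp add: emeasure_law[OF A])
    have add: "expect (\<lambda>v. g v + ?e v) (t' - t) 0 = expect g (t' - t) 0 + expect ?e (t' - t) 0"
      if [measurable]: "g \<in> borel_measurable borel" for g
      unfolding expect_def by (rule nn_integral_add) measurable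
    have "emeasure (law x t) A \<le> emeasure (law 0 t') A + ennreal (D x * exp (- \<alpha> * t))"
    proof -
      \<comment> \<open>Averaging a constant over the random start lets the coupling be applied
        pointwise in that start.\<close>
      have "emeasure (law x t) A = expect (\<lambda>_. expect ?f t x) (t' - t) 0"
        by (simp add: emeasure_law[OF A])
      also have "\<dots> \<le> expect (\<lambda>v. expect ?f t v + ?e v) (t' - t) 0"
        by (intro expect_mono coupling f f_le t)
      also have "\<dots> = emeasure (law 0 t') A + expect ?e (t' - t) 0"
        unfolding later by (rule add) measurable
      finally show ?thesis using moment[OF s, of t x] by (meson add_left_mono order_trans)
    qed
    then have "measure (law x t) A \<le> measure (law 0 t') A + D x * exp (- \<alpha> * t)"
      using D[of x] by (simp add: l.emeasure_eq_measure l'.emeasure_eq_measure flip: ennreal_plus)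
    moreover have "emeasure (law 0 t') A \<le> emeasure (law x t) A + ennreal (D x * exp (- \<alpha> * t))"
    proof -
      have "emeasure (law 0 t') A \<le> expect (\<lambda>v. expect ?f t x + ?e v) (t' - t) 0"
        unfolding later
      proof (rule expect_mono)
        fix v
        have swap: "B + exp (\<epsilon> * v) + exp (\<epsilon> * x) = B + exp (\<epsilon> * x) + exp (\<epsilon> * v)" by simp
        show "expect ?f t v \<le> expect ?f t x + ?e v"
          by (rule coupling[OF f f_le t(1), of v x, unfolded swap])
      qed
      also have "\<dots> = emeasure (law x t) A + expect ?e (t' - t) 0"
        by (subst add) (simp_all add: emeasure_law[OF A])
      finally show ?thesis using moment[OF s, of t x] by (meson add_left_mono order_trans)
    qed
    then have "measure (law 0 t') A \<le> measure (law x t) A + D x * exp (- \<alpha> * t)"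
      using D[of x] by (simp add: l.emeasure_eq_measure l'.emeasure_eq_measure flip: ennreal_plus)
    ultimately show ?thesis by (simp add: abs_le_iff)
  qed
  with \<alpha> D show thesis by (rule that)
qed

text \<open>Integer times suffice to define the limit; the estimate for all real \<open>t\<close>
  and all \<open>x\<close> follows by letting the second time in the Cauchy bound tend to infinity.
  Invariance holds because running the law at time \<open>n\<close> for a further time
  \<open>t\<close> gives the law at \<open>n + t\<close>, and both are close to \<pi>.\<close>

lemma stationary_law:
  assumes "0 < \<epsilon>" "integrable G (\<lambda>y. exp (2 * \<epsilon> * y))"
  obtains \<pi> \<alpha> D where "prob_space \<pi>" "sets \<pi> = sets borel" "emeasure \<pi> {0..} = 1" "0 < \<alpha>"
    "\<And>t A. 0 \<le> t \<Longrightarrow> A \<in> sets borel \<Longrightarrow> (\<integral>\<^sup>+x. emeasure (law x t) A \<partial>\<pi>) = emeasure \<pi> A"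
    "\<And>x t A. 0 \<le> t \<Longrightarrow> A \<in> sets borel \<Longrightarrow>
      \<bar>measure (law x t) A - measure \<pi> A\<bar> \<le> D x * exp (- \<alpha> * t)"
proof -
  obtain \<alpha> D where \<alpha>: "0 < \<alpha>" and D: "\<And>x. 0 \<le> D x" and cauchy:
    "\<And>x t t' A. 0 \<le> t \<Longrightarrow> t \<le> t' \<Longrightarrow> A \<in> sets borel \<Longrightarrow>
      \<bar>measure (law x t) A - measure (law 0 t') A\<bar> \<le> D x * exp (- \<alpha> * t)"
    using law_cauchy[OF assms] by blast
  define \<delta> where "\<delta> n = D 0 * exp (- \<alpha> * real n)" for n
  have \<delta>: "\<delta> \<longlonglongrightarrow> 0"
  proof -
    have "(\<lambda>n. D 0 * exp (- \<alpha>) ^ n) \<longlonglongrightarrow> D 0 * 0"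
      using \<alpha> by (intro tendsto_intros LIMSEQ_power_zero) simp
    moreover have "\<delta> = (\<lambda>n. D 0 * exp (- \<alpha>) ^ n)" by (simp add: fun_eq_iff \<delta>_def exp_of_nat2_mult[symmetric])
    ultimately show ?thesis by simp
  qed
  have \<delta>_cauchy: "\<bar>measure (law 0 (real n)) A - measure (law 0 (real m)) A\<bar> \<le> \<delta> n"
    if "n \<le> m" "A \<in> sets borel" for n m A
    unfolding \<delta>_def using that by (intro cauchy) auto
  obtain \<pi> where \<pi>: "prob_space \<pi>" and sets_\<pi>: "sets \<pi> = sets borel"
    and lim: "\<And>A. A \<in> sets borel \<Longrightarrow> (\<lambda>n. measure (law 0 (real n)) A) \<longlonglongrightarrow> measure \<pi> A"
    using uniform_limit_measure[of "\<lambda>n. law 0 (real n)" borel \<delta>, OF prob_space_law sets_law \<delta>_cauchy \<delta>]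
    by blast
  interpret \<pi>: prob_space \<pi> by (rule \<pi>)
  interpret law: prob_space "law x t" for x t by (rule prob_space_law)
  have conv: "\<bar>measure (law x t) A - measure \<pi> A\<bar> \<le> D x * exp (- \<alpha> * t)"
    if t: "0 \<le> t" and A: "A \<in> sets borel" for x t A
  proof (rule LIMSEQ_le_const2)
    show "(\<lambda>n. \<bar>measure (law x t) A - measure (law 0 (real n)) A\<bar>) \<longlonglongrightarrow> \<bar>measure (law x t) A - measure \<pi> A\<bar>"
      by (intro tendsto_intros lim A)
    obtain k where "t \<le> real k" using real_arch_simple by blast
    then show "\<exists>k. \<forall>n\<ge>k. \<bar>measure (law x t) A - measure (law 0 (real n)) A\<bar> \<le> D x * exp (- \<alpha> * t)"
      using t A by (intro exI[of _ k] allI impI cauchy) auto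
  qed
  have le: "emeasure (law 0 t) A \<le> emeasure \<pi> A + ennreal (D 0 * exp (- \<alpha> * t))"
    "emeasure \<pi> A \<le> emeasure (law 0 t) A + ennreal (D 0 * exp (- \<alpha> * t))"
    if "0 \<le> t" "A \<in> sets borel" for t A
    using conv[OF that, of 0] D[of 0]
    by (simp_all add: law.emeasure_eq_measure \<pi>.emeasure_eq_measure abs_le_iff flip: ennreal_plus)
  have le_\<delta>: "emeasure (law 0 (real n)) A \<le> emeasure \<pi> A + ennreal (\<delta> n)"
    "emeasure \<pi> A \<le> emeasure (law 0 (real n)) A + ennreal (\<delta> n)" if "A \<in> sets borel" for n A
    unfolding \<delta>_def using le[OF _ that, of "real n"] by simp_all
  have invariant: "(\<integral>\<^sup>+x. emeasure (law x t) A \<partial>\<pi>) = emeasure \<pi> A" (is "?I = _")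
    if t: "0 \<le> t" and A [measurable]: "A \<in> sets borel" for t A
  proof -
    have h [measurable]: "(\<lambda>x. emeasure (law x t) A) \<in> borel_measurable borel"
      by (simp add: emeasure_law[OF A])
    have sf: "sigma_finite_measure \<pi>" "sigma_finite_measure (law 0 s)" for s
      by (rule \<pi>.sigma_finite_measure_axioms law.sigma_finite_measure_axioms)+
    have step: "(\<integral>\<^sup>+x. emeasure (law x t) A \<partial>law 0 (real n)) = emeasure (law 0 (real n + t)) A" for n
      using chapman_kolmogorov[of "indicator A" "real n" t 0] t
      by (simp add: nn_integral_law emeasure_law[OF A] split: split_indicator)
    have \<delta>_mono: "D 0 * exp (- \<alpha> * (real n + t)) \<le> \<delta> n" for n
      unfolding \<delta>_def using D \<alpha> t by (intro mult_left_mono) auto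
    \<comment> \<open>One error replaces \<pi> by the law at time \<open>n\<close> under the
      integral, the other compares the law at \<open>n + t\<close> with \<pi>. Both vanish as
      \<open>n\<close> grows.\<close>
    have "?I \<le> emeasure \<pi> A + ennreal (\<delta> n) + ennreal (\<delta> n)"
      "emeasure \<pi> A \<le> ?I + ennreal (\<delta> n) + ennreal (\<delta> n)" for n
    proof -
      have "?I \<le> (\<integral>\<^sup>+x. emeasure (law x t) A \<partial>law 0 (real n)) + ennreal (\<delta> n)"
        by (rule nn_integral_le_of_emeasure_le[OF sf]) (use le_\<delta> in \<open>auto simp: sets_\<pi> law.emeasure_le_1\<close>)
      also have "\<dots> \<le> emeasure \<pi> A + ennreal (\<delta> n) + ennreal (\<delta> n)"
        unfolding step using le(1)[of "real n + t" A] t \<delta>_mono[of n]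
        by (intro add_right_mono) (auto intro: order_trans add_left_mono ennreal_leI)
      finally show "?I \<le> emeasure \<pi> A + ennreal (\<delta> n) + ennreal (\<delta> n)" .
      have "emeasure \<pi> A \<le> emeasure (law 0 (real n + t)) A + ennreal (\<delta> n)"
        using le(2)[of "real n + t" A] t \<delta>_mono[of n]
        by (auto intro: order_trans add_left_mono ennreal_leI)
      also have "emeasure (law 0 (real n + t)) A \<le> ?I + ennreal (\<delta> n)"
        unfolding step[symmetric]
        by (rule nn_integral_le_of_emeasure_le[OF sf(2,1)])
          (use le_\<delta> in \<open>auto simp: sets_\<pi> law.emeasure_le_1 measurable_cong_sets[OF sets_\<pi> refl]\<close>)
      finally show "emeasure \<pi> A \<le> ?I + ennreal (\<delta> n) + ennreal (\<delta> n)"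
        by (simp add: add_right_mono)
    qed
    note bounds = this
    have \<delta>': "(\<lambda>n. c + ennreal (\<delta> n) + ennreal (\<delta> n)) \<longlonglongrightarrow> c + ennreal 0 + ennreal 0" for c
      by (intro tendsto_intros \<delta>)
    show ?thesis
    proof (rule antisym)
      show "?I \<le> emeasure \<pi> A"
        using \<delta>'[of "emeasure \<pi> A"] bounds(1) by (intro LIMSEQ_le_const[where X = "\<lambda>n. emeasure \<pi> A + ennreal (\<delta> n) + ennreal (\<delta> n)"]) auto
      show "emeasure \<pi> A \<le> ?I"
        using \<delta>'[of ?I] bounds(2) by (intro LIMSEQ_le_const[where X = "\<lambda>n. ?I + ennreal (\<delta> n) + ennreal (\<delta> n)"]) auto
    qed
  qed
  have "measure (law 0 (real n)) {0..} = 1" for n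
    using emeasure_law_nonneg[of 0 "real n"] by (simp add: law.emeasure_eq_measure)
  then have "measure \<pi> {0..} = 1"
    using lim[of "{0..}"] by (simp add: LIMSEQ_const_iff)
  then have "emeasure \<pi> {0..} = 1" by (simp add: \<pi>.emeasure_eq_measure)
  then show thesis using \<pi> sets_\<pi> \<alpha> invariant conv by (intro that)
qed

end

section \<open>Transfer to the given probability space\<close>

lemma workload_at_arrival_cong:
  "(\<And>n. s (Suc n) = s' (Suc n)) \<Longrightarrow> workload_at_arrival \<tau> s x n = workload_at_arrival \<tau> s' x n"
  by (induction n) (simp_all add: workload_at_arrival_Suc)

lemma workload_cong:
  "(\<And>n. s (Suc n) = s' (Suc n)) \<Longrightarrow> workload \<tau> s x t = workload \<tau> s' x t"
  unfolding workload_def by (subst workload_at_arrival_cong[of s s']) auto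

text \<open>Reindexing by \<open>Suc\<close> turns a family indexed by \<open>{1..}\<close> into a
  point of the full sequence space, on which the first-coordinate decomposition is
  available.\<close>

lemma (in prob_space) distr_shifted_iid:
  fixes X :: "nat \<Rightarrow> 'a \<Rightarrow> real"
  assumes indep: "indep_vars (\<lambda>_. borel) X {1..}"
    and distr: "\<And>i. 1 \<le> i \<Longrightarrow> distr M borel (X i) = N"
    and N: "prob_space N" and sets_N: "sets N = sets borel"
  shows "distr M (\<Pi>\<^sub>M i\<in>UNIV. borel) (\<lambda>\<omega> i. X (Suc i) \<omega>) = (\<Pi>\<^sub>M (i::nat)\<in>UNIV. N)"
proof -
  have X: "random_variable borel (X i)" if "i \<in> {1..}" for i
    using indep that by (simp add: indep_vars_def)
  have "distr M (\<Pi>\<^sub>M i\<in>{1..}. borel) (\<lambda>\<omega>. \<lambda>i\<in>{1..}. X i \<omega>) = (\<Pi>\<^sub>M i\<in>{1..}. distr M borel (X i))"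
    using indep X by (subst (asm) indep_vars_iff_distr_eq_PiM') auto
  also have "\<dots> = (\<Pi>\<^sub>M (i::nat)\<in>{1..}. N)"
    by (intro PiM_cong) (auto simp: distr)
  finally have joint: "distr M (\<Pi>\<^sub>M i\<in>{1..}. borel) (\<lambda>\<omega>. \<lambda>i\<in>{1..}. X i \<omega>) = (\<Pi>\<^sub>M (i::nat)\<in>{1..}. N)" .
  have "(\<Pi>\<^sub>M (i::nat)\<in>UNIV. N) =
      distr (\<Pi>\<^sub>M i\<in>{1..}. N) (\<Pi>\<^sub>M i\<in>UNIV. N) (\<lambda>\<omega>. \<lambda>n\<in>UNIV. \<omega> (Suc n))"
    by (rule distr_PiM_reindex[symmetric]) (auto simp: N)
  also have "\<dots> = distr (\<Pi>\<^sub>M i\<in>{1..}. N) (\<Pi>\<^sub>M i\<in>UNIV. borel) (\<lambda>\<omega> n. \<omega> (Suc n))"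
    by (intro distr_cong refl sets_PiM_cong) (simp_all add: sets_N fun_eq_iff)
  also have "\<dots> = distr M (\<Pi>\<^sub>M i\<in>UNIV. borel) ((\<lambda>\<omega> n. \<omega> (Suc n)) \<circ> (\<lambda>\<omega>. \<lambda>i\<in>{1..}. X i \<omega>))"
    unfolding joint[symmetric]
  proof (rule distr_distr)
    show "(\<lambda>\<omega> n. \<omega> (Suc n)) \<in> measurable (\<Pi>\<^sub>M i\<in>{1..}. borel) (\<Pi>\<^sub>M i\<in>UNIV. borel :: real measure)"
      by (intro measurable_abs_UNIV measurable_component_singleton) simp
    show "(\<lambda>\<omega>. \<lambda>i\<in>{1..}. X i \<omega>) \<in> measurable M (\<Pi>\<^sub>M i\<in>{1..}. borel)"
      by (intro measurable_restrict X)
  qed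
  also have "(\<lambda>\<omega> n. \<omega> (Suc n)) \<circ> (\<lambda>\<omega>. \<lambda>i\<in>{1..}. X i \<omega>) = (\<lambda>\<omega> n. X (Suc n) \<omega>)"
    by (auto simp: fun_eq_iff)
  finally show ?thesis ..
qed

context mg1_input begin

sublocale canonical_input G rate
  by (intro canonical_input.intro prob_space_G canonical_input_axioms.intro rate_pos sets_G)

lemma distr_interarrival: "1 \<le> i \<Longrightarrow> distr M borel (\<lambda>\<omega>. T i \<omega> - T (i - 1) \<omega>) = gap"
  using distributed_distr_eq_density[OF interarrival_distributed[of i]]
  by (simp add: gap_def cong: distr_cong)

text \<open>Gaps are a measurable image of the arrival epochs and shifted services one of the
  services, so the independence of the two families is inherited and the joint law is the
  product.\<close>

lemma distr_input:
  "distr M ((\<Pi>\<^sub>M i\<in>UNIV. borel) \<Otimes>\<^sub>M (\<Pi>\<^sub>M i\<in>UNIV. borel))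
    (\<lambda>\<omega>. (\<lambda>i. T (Suc i) \<omega> - T i \<omega>, \<lambda>i. S (Suc i) \<omega>)) = input"
proof -
  let ?d = "\<lambda>\<tau> i. \<tau> (Suc i) - \<tau> i :: real" and ?sh = "\<lambda>s i. s (Suc i) :: real"
  have "indep_var (\<Pi>\<^sub>M i\<in>UNIV. borel) (?d \<circ> (\<lambda>\<omega>. \<lambda>n\<in>UNIV. T n \<omega>))
      (\<Pi>\<^sub>M i\<in>UNIV. borel) (?sh \<circ> (\<lambda>\<omega>. \<lambda>n\<in>{1..}. S n \<omega>))"
  proof (rule indep_var_compose[OF arrival_service_indep])
    show "?d \<in> measurable (\<Pi>\<^sub>M n\<in>UNIV. borel) (\<Pi>\<^sub>M i\<in>UNIV. borel)"
      by (intro measurable_abs_UNIV) measurable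
    show "?sh \<in> measurable (\<Pi>\<^sub>M n\<in>{1..}. borel) (\<Pi>\<^sub>M i\<in>UNIV. borel)"
      by (intro measurable_abs_UNIV measurable_component_singleton) simp
  qed
  moreover have "?d \<circ> (\<lambda>\<omega>. \<lambda>n\<in>UNIV. T n \<omega>) = (\<lambda>\<omega> i. T (Suc i) \<omega> - T i \<omega>)"
    "?sh \<circ> (\<lambda>\<omega>. \<lambda>n\<in>{1..}. S n \<omega>) = (\<lambda>\<omega> i. S (Suc i) \<omega>)"
    by (auto simp: fun_eq_iff)
  ultimately have indep: "indep_var (\<Pi>\<^sub>M i\<in>UNIV. borel) (\<lambda>\<omega> i. T (Suc i) \<omega> - T i \<omega>)
      (\<Pi>\<^sub>M i\<in>UNIV. borel) (\<lambda>\<omega> i. S (Suc i) \<omega>)"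
    by simp
  have "distr M (\<Pi>\<^sub>M i\<in>UNIV. borel) (\<lambda>\<omega> i. T (Suc i) \<omega> - T i \<omega>) = gaps.S"
    using distr_shifted_iid[OF interarrival_indep distr_interarrival gap.prob_space_axioms sets_gap] by simp
  moreover have "distr M (\<Pi>\<^sub>M i\<in>UNIV. borel) (\<lambda>\<omega> i. S (Suc i) \<omega>) = services.S"
    by (rule distr_shifted_iid[OF service_indep service_distr prob_space_G sets_G])
  ultimately show ?thesis
    using indep unfolding indep_var_distribution_eq input_def by simp
qed

lemma model2_eq_workload_path:
  assumes "\<omega> \<in> space M"
  shows "model2 T S x t \<omega> = workload_path (\<lambda>i. T (Suc i) \<omega> - T i \<omega>) (\<lambda>i. S (Suc i) \<omega>) x t"
proof -
  have "(\<lambda>n. T n \<omega>) = (\<lambda>n. \<Sum>i<n. T (Suc i) \<omega> - T i \<omega>)"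
    using sum_lessThan_telescope[of "\<lambda>i. T i \<omega>"] by (simp add: T_0[OF assms])
  then show ?thesis
    \<comment> \<open>By truncated subtraction, \<open>Suc (n - 1)\<close> differs from
      \<open>n\<close> only at \<open>n = 0\<close>, an index whose service is never read.\<close>
    unfolding model2_def workload_path_def by (simp add: workload_cong[of "\<lambda>n. S n \<omega>" "\<lambda>n. S (Suc (n - 1)) \<omega>"])
qed

lemma distr_model2: "distr M borel (model2 T S x t) = law x t"
proof -
  have [measurable]: "(\<lambda>\<omega>. (\<lambda>i. T (Suc i) \<omega> - T i \<omega>, \<lambda>i. S (Suc i) \<omega>)) \<in>
      measurable M ((\<Pi>\<^sub>M i\<in>UNIV. borel) \<Otimes>\<^sub>M (\<Pi>\<^sub>M i\<in>UNIV. borel))"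
  proof -
    have "T n \<in> borel_measurable M" for n
      using measurable_compose[OF indep_var_rv1[OF arrival_service_indep] measurable_component_singleton[of n]] by simp
    then show ?thesis
      using service_measurable by (intro measurable_Pair measurable_abs_UNIV) auto
  qed
  have "distr M borel (model2 T S x t) =
      distr M borel ((\<lambda>w. workload_path (fst w) (snd w) x t) \<circ> (\<lambda>\<omega>. (\<lambda>i. T (Suc i) \<omega> - T i \<omega>, \<lambda>i. S (Suc i) \<omega>)))"
    by (intro distr_cong) (simp_all add: model2_eq_workload_path)
  also have "\<dots> = law x t"
    unfolding law_def distr_input[symmetric] by (rule distr_distr[symmetric]) measurable
  finally show ?thesis .
qed

end

theorem theorem5:
  fixes M :: "'a measure" and rate :: real and G :: "real measure"
    and T S :: "nat \<Rightarrow> 'a \<Rightarrow> real"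
  assumes "mg1_input M rate G T S"
    and "\<exists>r>1. integrable M (\<lambda>\<omega>. r powr S 1 \<omega>)"
  shows "geometrically_ergodic M (model2 T S)"
proof -
  interpret mg1_input M rate G T S by fact
  obtain r where r: "1 < r" "integrable M (\<lambda>\<omega>. r powr S 1 \<omega>)" using assms(2) by blast
  \<comment> \<open>Chosen so that \<open>exp (2 * \<epsilon> * y)\<close> is
    \<open>r powr y\<close>.\<close>
  define \<epsilon> where "\<epsilon> = ln r / 2"
  have \<epsilon>: "0 < \<epsilon>" using r by (simp add: \<epsilon>_def)
  have "integrable (distr M borel (S 1)) (\<lambda>y. exp (2 * \<epsilon> * y))"
    using r service_measurable[of 1]
    by (subst integrable_distr_eq) (auto simp: \<epsilon>_def powr_def mult.commute)
  then have int: "integrable G (\<lambda>y. exp (2 * \<epsilon> * y))" by (simp add: service_distr)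
  obtain \<pi> \<alpha> D where \<pi>: "prob_space \<pi>" "sets \<pi> = sets borel" "emeasure \<pi> {0..} = 1" and \<alpha>: "0 < \<alpha>"
    and invariant: "\<And>t A. 0 \<le> t \<Longrightarrow> A \<in> sets borel \<Longrightarrow> (\<integral>\<^sup>+x. emeasure (law x t) A \<partial>\<pi>) = emeasure \<pi> A"
    and conv: "\<And>x t A. 0 \<le> t \<Longrightarrow> A \<in> sets borel \<Longrightarrow>
      \<bar>measure (law x t) A - measure \<pi> A\<bar> \<le> D x * exp (- \<alpha> * t)"
    using stationary_law[OF \<epsilon> int] by blast
  interpret \<pi>: prob_space \<pi> by fact
  \<comment> \<open>Restricting the integral to \<open>{0..}\<close>, as the definition of
    invariance does, changes nothing for a law concentrated there.\<close>
  have "AE x in \<pi>. x \<in> {0..}"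
    using \<pi> by (intro \<pi>.AE_prob_1) (simp add: \<pi>.emeasure_eq_measure)
  then have "(\<integral>\<^sup>+x\<in>{0..}. emeasure (law x t) A \<partial>\<pi>) = emeasure \<pi> A" if "0 \<le> t" "A \<in> sets borel" for t A
    using invariant[OF that, symmetric] by (auto intro!: nn_integral_cong_AE)
  then have "invariant_distribution M (model2 T S) \<pi>"
    unfolding invariant_distribution_def distr_model2 using \<pi> by blast
  moreover have "\<exists>C>0. \<forall>t\<ge>0. tv_dist (law x t) \<pi> \<le> C * exp (- \<alpha> * t)" for x
  \<comment> \<open>\<open>D x\<close> comes without a sign, while geometric ergodicity asks for a
    positive constant.\<close>
  proof (intro exI[of _ "\<bar>D x\<bar> + 1"] conjI allI impI)
    fix t :: real assume t: "0 \<le> t"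
    have "D x * exp (- \<alpha> * t) \<le> (\<bar>D x\<bar> + 1) * exp (- \<alpha> * t)"
      by (intro mult_right_mono) auto
    then show "tv_dist (law x t) \<pi> \<le> (\<bar>D x\<bar> + 1) * exp (- \<alpha> * t)"
      unfolding tv_dist_def using order_trans[OF conv[OF t]] by (intro cSUP_least) blast+
  qed simp
  ultimately show ?thesis
    unfolding geometrically_ergodic_def distr_model2 using \<alpha> by blast
qed

end
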